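(* Let $d\ge 1$ and let $\mathbf{x}:[0,1]\to\mathbb{R}^d$ be a cyclic curve. Then $$\operatorname{vol}(\operatorname{conv}(\mathbf{x})) = \alpha^{(d)}(\mathbf{x}).$$
   Context: All paths are Lipschitz-continuous maps $\mathbf{x}=(x_1,\dots,x_d):[0,1]\to\mathbb{R}^d$; their derivatives $\mathbf{x}'$ exist almost everywhere. A Lipschitz path $\mathbf{x}:[0,1]\to\mathbb{R}^d$ is a $d$-order path (or $d$-order curve) if $$\det\begin{pmatrix}1&1&\cdots&1\\ \mathbf{x}(t_0)&\mathbf{x}(t_1)&\cdots&\mathbf{x}(t_d)\end{pmatrix}>0\qquad\text{for all }0\le t_0<t_1<\dots<t_d\le 1 .$$ A Lipschitz path $\mathbf{x}:[0,1]\to\mathbb{R}^d$ is cyclic if it is the uniform limit on $[0,1]$ of a sequence of $d$-order paths. $\operatorname{conv}(\mathbf{x})$ is the convex hull of the image $\mathbf{x}([0,1])$ and $\operatorname{vol}$ is $d$-dimensional Lebesgue measure. With $\Delta^d=\{0\le t_1<\dots<t_d\le 1\}$, the level $d$ alternating signature of $\mathbf{x}$ is the real number $$\alpha^{(d)}(\mathbf{x})=\frac{1}{d!}\int_{\Delta^d}\det(\mathbf{x}'(t_1),\dots,\mathbf{x}'(t_d))\,\mathrm{d}t_1\cdots\mathrm{d}t_d .$$ *)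

theory Defs
  imports "HOL-Analysis.Analysis" "HOL-Library.Option_ord"
begin

text \<open>
  A path in \<open>\<real>\<^sup>d\<close> is a function \<open>real \<Rightarrow> real ^ 'n\<close> of which only the restriction to
  \<open>{0..1}\<close> matters. The determinants below have time-indexed columns and coordinate-indexed rows
  and are alternating in each, so the coordinates must be ordered: \<open>'n\<close> is a finite linearly
  ordered type with \<open>d = CARD('n)\<close>, standing for \<open>1 < \<dots> < d\<close>. The type \<open>'n option\<close>, with
  \<open>None\<close> as its least element, stands for \<open>0 < 1 < \<dots> < d\<close>.
\<close>

definition lipschitz_path :: "(real \<Rightarrow> real ^ 'n) \<Rightarrow> bool" where
  "lipschitz_path x \<longleftrightarrow> (\<exists>L. L-lipschitz_on {0..1} x)"

definition order_matrix ::
    "(real \<Rightarrow> real ^ 'n) \<Rightarrow> ('n option \<Rightarrow> real) \<Rightarrow> real ^ ('n option) ^ ('n option)" where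
  "order_matrix x t = (\<chi> i j. case i of None \<Rightarrow> 1 | Some k \<Rightarrow> x (t j) $ k)"

definition order_path :: "(real \<Rightarrow> real ^ 'n::{finite,linorder}) \<Rightarrow> bool" where
  "order_path x \<longleftrightarrow> lipschitz_path x \<and>
     (\<forall>t. strict_mono t \<and> range t \<subseteq> {0..1} \<longrightarrow> det (order_matrix x t) > 0)"

definition cyclic_path :: "(real \<Rightarrow> real ^ 'n::{finite,linorder}) \<Rightarrow> bool" where
  "cyclic_path x \<longleftrightarrow> lipschitz_path x \<and>
     (\<exists>y :: nat \<Rightarrow> real \<Rightarrow> real ^ 'n::{finite,linorder}.
        (\<forall>m. order_path (y m)) \<and> uniform_limit {0..1} y x sequentially)"

definition time_simplex :: "(real ^ 'n::{finite,linorder}) set" where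
  "time_simplex = {t. (\<forall>i. 0 \<le> t $ i \<and> t $ i \<le> 1) \<and> (\<forall>i j. i < j \<longrightarrow> t $ i < t $ j)}"

text \<open>
  For a Lipschitz path the derivative exists almost everywhere; elsewhere \<^const>\<open>vector_derivative\<close>
  takes an unspecified value, which affects the integrand on a null set only.
\<close>

definition alternating_signature :: "(real \<Rightarrow> real ^ 'n::{finite,linorder}) \<Rightarrow> real" where
  "alternating_signature x =
     1 / fact CARD('n) *
     (LINT t:time_simplex|lebesgue.
        det (\<chi> i j. vector_derivative x (at (t $ j) within {0..1}) $ i))"

end

theory Submission imports Defs begin

text \<open>
  For a partition of \<open>[0,1]\<close> into \<open>N\<close> equal intervals, the points \<open>v i = x (i / N)\<close> of an order path are
  the vertices of a cyclic polytope. Lifting them by rapidly decreasing heights induces a triangulation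
  whose simplices are given by Gale's evenness condition, and the sum of the (positive) determinants of
  these simplices telescopes to the sum of the determinants of the increments of \<open>v\<close> over all
  increasing index tuples. This identity between the volume of the hull and a Riemann sum of the
  signature passes to uniform limits for fixed \<open>N\<close>, hence holds for cyclic paths although the Lipschitz
  constants of the approximating order paths may be unbounded. As \<open>N\<close> tends to infinity, the volumes
  converge because the hulls do, and the Riemann sums converge to the signature by Lebesgue's
  differentiation theorem and dominated convergence.
\<close>

section \<open>Determinants of lists of vectors\<close>

text \<open>Triangulation and telescoping yield the same index lists. In a sum of determinants of
  increments over k_1 < ... < k_d, the index k_1 contributes the edge from k_1 to k_1 + 1, the index
  k_2 runs over everything between k_1 and k_3 so that its increments add up to the step from k_1 +
  1 to k_3, and so on. What survives are paths through adjacent pairs k, k + 1, ended by the last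
  vertex N when d is even. These are the lists that satisfy Gale's condition, and the determinant of
  the consecutive differences along such a path is d! times the volume of its simplex. Strict
  positivity of the ordered determinants enters three times: it makes the simplices non-degenerate,
  it fixes on which side of a lifted simplex every other lifted point lies, and it removes the
  absolute value from the volumes. All three may fail for a cyclic path itself, so the geometry is
  done for order paths only.\<close>

definition idx :: "'m::{finite,linorder} \<Rightarrow> nat" where
  "idx k = card {..<k}"

lemma strict_mono_idx: "strict_mono (idx :: 'm::{finite,linorder} \<Rightarrow> nat)"
  unfolding idx_def by (intro strict_monoI psubset_card_mono) auto

lemma idx_less: "idx (k::'m::{finite,linorder}) < CARD('m)"
  unfolding idx_def by (intro psubset_card_mono) auto

lemma bij_betw_idx: "bij_betw idx (UNIV :: 'm::{finite,linorder} set) {..<CARD('m)}"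
proof -
  have inj: "inj (idx :: 'm \<Rightarrow> nat)"
    using strict_mono_idx by (rule strict_mono_imp_inj_on)
  moreover have "range (idx :: 'm \<Rightarrow> nat) \<subseteq> {..<CARD('m)}" using idx_less by auto
  ultimately have "range (idx :: 'm \<Rightarrow> nat) = {..<CARD('m)}"
    by (intro card_subset_eq) (auto simp: card_image)
  then show ?thesis using inj by (simp add: bij_betw_def)
qed

lemma obtain_idx:
  assumes "r < CARD('m)"
  obtains k :: "'m::{finite,linorder}" where "idx k = r"
  using assms bij_betw_imp_surj_on[OF bij_betw_idx[where 'm = 'm]] by (metis imageE lessThan_iff)

lemma idx_eq_iff: "idx j = idx k \<longleftrightarrow> j = k"
  using strict_mono_imp_inj_on[OF strict_mono_idx, of UNIV] by (auto simp: inj_on_def)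

lemma idx_None: "idx (None :: 'm::{finite,linorder} option) = 0"
  by (simp add: idx_def lessThan_def)

lemma idx_Some: "idx (Some k :: 'm::{finite,linorder} option) = Suc (idx k)"
proof -
  have "{..<Some k} = insert None (Some ` {..<k})"
  proof (rule set_eqI)
    fix x show "x \<in> {..<Some k} \<longleftrightarrow> x \<in> insert None (Some ` {..<k})" by (cases x) auto
  qed
  then show ?thesis by (simp add: idx_def card_image)
qed

text \<open>Lists instead of matrices, so that recursions over index tuples can produce rows from
  the front. It is meant for lists of length \<open>CARD('m)\<close>.\<close>

definition ldet :: "(real ^ 'm::{finite,linorder}) list \<Rightarrow> real" where
  "ldet ws = det (\<chi> k. ws ! idx k)"

text \<open>Brings a list entry into the shape \<open>if i = k then c else M i\<close> in which
  \<open>det_row_add\<close> and \<open>det_row_mul\<close> express linearity in a row.\<close>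

lemma ldet_slot:
  fixes xs ys :: "(real ^ 'm::{finite,linorder}) list"
  assumes "length xs < CARD('m)"
  obtains k M where "\<And>c. ldet (xs @ c # ys) = det (\<chi> i. if i = k then c else M i)"
proof -
  obtain k :: 'm where k: "idx k = length xs" using assms by (rule obtain_idx)
  have "(xs @ c # ys) ! idx i = (if i = k then c else (xs @ 0 # ys) ! idx i)" for c i
    using k idx_eq_iff[of i k] by (auto simp: nth_append nth_Cons split: nat.split)
  then show thesis by (intro that[of k "\<lambda>i. (xs @ 0 # ys) ! idx i"]) (simp add: ldet_def)
qed

lemma linear_ldet:
  fixes xs ys :: "(real ^ 'm::{finite,linorder}) list"
  assumes "length xs < CARD('m)"
  shows "linear (\<lambda>c. ldet (xs @ c # ys))"
proof -
  obtain k M where *: "\<And>c. ldet (xs @ c # ys) = det (\<chi> i. if i = k then c else M i)"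
    using ldet_slot[OF assms] by blast
  show ?thesis
    unfolding *
  proof (rule linearI)
    fix x y :: "(real, 'm) vec" and c :: real
    show "det (\<chi> i. if i = k then x + y else M i) = det (\<chi> i. if i = k then x else M i) + det (\<chi> i. if i = k then y else M i)"
      by (rule det_row_add)
    show "det (\<chi> i. if i = k then c *\<^sub>R x else M i) = c *\<^sub>R det (\<chi> i. if i = k then x else M i)"
      using det_row_mul[of k c "\<lambda>_. x" M] unfolding scalar_mult_eq_scaleR by simp
  qed
qed

lemma ldet_not_distinct:
  fixes ws :: "(real ^ 'm::{finite,linorder}) list"
  assumes "length ws = CARD('m)" "\<not> distinct ws"
  shows "ldet ws = 0"
proof -
  obtain r s where rs: "r < length ws" "s < length ws" "r \<noteq> s" "ws ! r = ws ! s"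
    using assms(2) by (auto simp: distinct_conv_nth)
  obtain i :: 'm where i: "idx i = r" using rs assms obtain_idx[of r thesis] by auto
  obtain j :: 'm where j: "idx j = s" using rs assms obtain_idx[of s thesis] by auto
  show ?thesis unfolding ldet_def
    by (rule det_identical_rows[of i j]) (use i j rs in \<open>auto simp: row_def vec_eq_iff\<close>)
qed

text \<open>Polarisation: the determinant with \<open>a + b\<close> in both slots vanishes, and
  expanding it leaves only the two mixed terms.\<close>

lemma ldet_swap:
  fixes xs ys :: "(real ^ 'm::{finite,linorder}) list"
  assumes len: "length xs + length ys + 2 = CARD('m)"
  shows "ldet (xs @ a # b # ys) = - ldet (xs @ b # a # ys)"
proof -
  have 1: "linear (\<lambda>c. ldet (xs @ c # e # ys))" for e
    by (rule linear_ldet) (use len in simp)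
  have 2: "linear (\<lambda>c. ldet (xs @ e # c # ys))" for e
    using linear_ldet[of "xs @ [e]" ys] len by simp
  have 0: "ldet (xs @ c # c # ys) = 0" for c
    by (rule ldet_not_distinct) (use len in auto)
  show ?thesis
    using 0[of "a + b"] 0[of a] 0[of b]
    by (simp add: linear_add[OF 1] linear_add[OF 2])
qed

text \<open>One swap for each element of \<open>ys\<close>. This carries a new vertex from the front
  to its sorted position, where the sign of the determinant is known.\<close>

lemma ldet_move:
  fixes xs ys zs :: "(real ^ 'm::{finite,linorder}) list"
  assumes "length xs + length ys + length zs + 1 = CARD('m)"
  shows "ldet (xs @ a # ys @ zs) = (-1) ^ length ys * ldet (xs @ ys @ a # zs)"
  using assms
proof (induction ys arbitrary: xs)
  case (Cons y ys)
  have "ldet (xs @ a # (y # ys) @ zs) = - ldet ((xs @ [y]) @ a # ys @ zs)"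
    using Cons.prems ldet_swap[of xs "ys @ zs" a y] by simp
  also have "\<dots> = - ((-1) ^ length ys * ldet ((xs @ [y]) @ ys @ a # zs))"
    using Cons.prems by (subst Cons.IH) auto
  finally show ?case by simp
qed simp

lemma ldet_add_span:
  fixes xs ys :: "(real ^ 'm::{finite,linorder}) list"
  assumes len: "length xs + length ys + 1 = CARD('m)" and u: "u \<in> span (set xs \<union> set ys)"
  shows "ldet (xs @ (c + u) # ys) = ldet (xs @ c # ys)"
proof -
  have lin: "linear (\<lambda>c. ldet (xs @ c # ys))"
    by (rule linear_ldet) (use len in simp)
  have "ldet (xs @ u # ys) = 0"
    by (rule linear_eq_0_on_span[OF lin _ u], rule ldet_not_distinct) (use len in auto)
  then show ?thesis by (simp add: linear_add[OF lin])
qed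

text \<open>An invertible linear system with the vectors as rows. With heights for \<open>f\<close>,
  the solution \<open>z\<close> is the hyperplane through the lifted points.\<close>

lemma ldet_dual:
  fixes V :: "'a \<Rightarrow> real ^ 'm::{finite,linorder}"
  assumes "length as = CARD('m)" "ldet (map V as) \<noteq> 0"
  shows "\<exists>z. \<forall>a\<in>set as. z \<bullet> V a = f a"
proof -
  define M :: "((real, 'm) vec, 'm) vec" where "M = (\<chi> k. map V as ! idx k)"
  have "invertible M" using assms by (simp add: M_def ldet_def invertible_det_nz)
  then obtain N where N: "M ** N = mat 1" by (auto simp: invertible_def)
  define z where "z = N *v (\<chi> k. f (as ! idx k))"
  have Mz: "M *v z = (\<chi> k. f (as ! idx k))"
    by (simp add: z_def matrix_vector_mul_assoc N)
  have "z \<bullet> V a = f a" if a: "a \<in> set as" for a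
  proof -
    obtain r where r: "r < length as" "as ! r = a" using a by (auto simp: in_set_conv_nth)
    obtain k :: 'm where k: "idx k = r" using r assms obtain_idx[of r thesis] by auto
    have "(M *v z) $ k = f a" by (simp add: Mz k r)
    then show ?thesis using r k by (simp add: matrix_vector_mul_component M_def inner_commute)
  qed
  then show ?thesis by blast
qed

text \<open>The transposed system. The coefficients are indexed by list entries rather than by
  \<open>'m\<close>, because later arguments add and remove vertices.\<close>

lemma ldet_spanning:
  fixes V :: "'a \<Rightarrow> real ^ 'm::{finite,linorder}"
  assumes "length as = CARD('m)" "ldet (map V as) \<noteq> 0"
  shows "\<exists>c. W = (\<Sum>a\<in>set as. c a *\<^sub>R V a)"
proof -
  define M :: "((real, 'm) vec, 'm) vec" where "M = (\<chi> k. map V as ! idx k)"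
  have "distinct (map V as)" using assms ldet_not_distinct[of "map V as"] by auto
  then have dist: "distinct as" by (simp add: distinct_map)
  have "invertible (transpose M)" using assms by (simp add: M_def ldet_def invertible_det_nz)
  then obtain N where N: "transpose M ** N = mat 1" by (auto simp: invertible_def)
  define y where "y = N *v W"
  have "W = transpose M *v y" by (simp add: y_def matrix_vector_mul_assoc N)
  also have "\<dots> = (\<Sum>k\<in>UNIV. y $ k *\<^sub>R V (as ! idx k))"
    unfolding matrix_mult_sum
    by (rule sum.cong) (use assms idx_less[where 'm = 'm] in \<open>auto simp: column_transpose scalar_mult_eq_scaleR row_def M_def vec_eq_iff\<close>)
  also have "\<dots> = (\<Sum>r<CARD('m). y $ inv_into UNIV idx r *\<^sub>R V (as ! r))"
    by (rule sum.reindex_bij_witness[of _ "inv_into UNIV idx" idx])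
       (use bij_betw_idx[where 'm='m] in \<open>auto simp: bij_betw_def inv_into_f_f f_inv_into_f idx_less\<close>)
  also have "\<dots> = (\<Sum>a\<in>set as. y $ inv_into UNIV idx (inv_into {..<CARD('m)} ((!) as) a) *\<^sub>R V a)"
  proof (rule sum.reindex_bij_witness[of _ "inv_into {..<CARD('m)} ((!) as)" "(!) as"])
    have inj: "inj_on ((!) as) {..<CARD('m)}" using dist assms(1) by (intro inj_on_nth) auto
    have img: "(!) as ` {..<CARD('m)} = set as" using assms(1) by (auto simp: in_set_conv_nth)
    show "inv_into {..<CARD('m)} ((!) as) (as ! r) = r" if "r \<in> {..<CARD('m)}" for r
      using inj that by simp
    show "inv_into {..<CARD('m)} ((!) as) a \<in> {..<CARD('m)}" if "a \<in> set as" for a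
      using that img inv_into_into[of a "(!) as" "{..<CARD('m)}"] by auto
    show "as ! inv_into {..<CARD('m)} ((!) as) a = a" if "a \<in> set as" for a
      using that img f_inv_into_f[of a "(!) as" "{..<CARD('m)}"] by auto
    show "y $ inv_into UNIV idx (inv_into {..<CARD('m)} ((!) as) (as ! r)) *\<^sub>R V (as ! r) =
         y $ inv_into UNIV idx r *\<^sub>R V (as ! r)" if "r \<in> {..<CARD('m)}" for r
      using inj that by simp
  qed (use assms(1) in auto)
  finally show ?thesis
    by (intro exI[of _ "\<lambda>a. y $ inv_into UNIV idx (inv_into {..<CARD('m)} ((!) as) a)"])
qed

text \<open>Cramer's rule: every summand of \<open>W\<close> other than the first repeats a row of
  \<open>as\<close>.\<close>

lemma ldet_head_coefficient:
  fixes V :: "'a \<Rightarrow> real ^ 'm::{finite,linorder}"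
  assumes "length (a # as) = CARD('m)" "distinct (a # as)" "W = (\<Sum>b\<in>set (a # as). c b *\<^sub>R V b)"
  shows "ldet (W # map V as) = c a * ldet (V a # map V as)"
proof -
  have lin: "linear (\<lambda>w. ldet (w # map V as))" using linear_ldet[of "[]" "map V as"] by simp
  have "ldet (W # map V as) = (\<Sum>b\<in>set (a # as). c b * ldet (V b # map V as))"
    unfolding assms(3) linear_sum[OF lin] by (simp add: linear_scale[OF lin])
  also have "\<dots> = c a * ldet (V a # map V as) + (\<Sum>b\<in>set as. c b * ldet (V b # map V as))"
    using assms(2) by simp
  also have "(\<Sum>b\<in>set as. c b * ldet (V b # map V as)) = 0"
    by (intro sum.neutral ballI) (use assms(1) in \<open>auto intro!: ldet_not_distinct\<close>)
  finally show ?thesis by simp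
qed

section \<open>Consecutive differences and homogeneous coordinates\<close>

fun cdiffs :: "'v::ab_group_add list \<Rightarrow> 'v list" where
  "cdiffs (x # y # ws) = (y - x) # cdiffs (y # ws)"
| "cdiffs _ = []"

lemma length_cdiffs [simp]: "length (cdiffs ws) = length ws - 1"
  by (induction ws rule: cdiffs.induct) auto

text \<open>Row reduction from the left: \<open>w - x0\<close> is \<open>(w - x) + (x - x0)\<close>,
  and the second summand lies in the span of the rows already treated. The span hypothesis is the
  invariant of the induction.\<close>

lemma ldet_cdiffs_aux:
  fixes us ws :: "(real ^ 'm::{finite,linorder}) list"
  assumes "length us + length ws = CARD('m)" "x - x0 \<in> span (set us)"
  shows "ldet (us @ cdiffs (x # ws)) = ldet (us @ map (\<lambda>w. w - x0) ws)"
  using assms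
proof (induction ws arbitrary: us x)
  case (Cons w ws)
  have "ldet (us @ ((w - x) + (x - x0)) # cdiffs (w # ws)) = ldet (us @ (w - x) # cdiffs (w # ws))"
    using Cons.prems span_mono[of "set us" "set us \<union> set (cdiffs (w # ws))"]
    by (intro ldet_add_span) auto
  moreover have "ldet ((us @ [w - x0]) @ cdiffs (w # ws)) = ldet ((us @ [w - x0]) @ map (\<lambda>w. w - x0) ws)"
    by (rule Cons.IH) (use Cons.prems in \<open>auto intro: span_base\<close>)
  ultimately show ?case by simp
qed simp

lemma ldet_cdiffs:
  fixes ws :: "(real ^ 'm::{finite,linorder}) list"
  assumes "length ws = CARD('m)"
  shows "ldet (cdiffs (x # ws)) = ldet (map (\<lambda>w. w - x) ws)"
  using ldet_cdiffs_aux[of "[]" ws x x] assms by (simp add: span_zero)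

text \<open>Laplace expansion along the column \<open>None\<close>, read off the Leibniz sum: a
  permutation that moves \<open>None\<close> picks up a zero from this column, and those that fix
  \<open>None\<close> are the permutations of \<open>range Some\<close>.\<close>

lemma det_option_block:
  fixes A :: "real ^ ('n::finite option) ^ ('n option)"
  assumes "\<And>i. A $ Some i $ None = 0" "A $ None $ None = 1"
  shows "det A = det (\<chi> i j. A $ Some i $ Some j)"
proof -
  let ?t = "\<lambda>p. of_int (sign p) * (\<Prod>k\<in>UNIV. A $ k $ p k)"
  let ?m = "map_permutation UNIV (Some :: 'n \<Rightarrow> 'n option)"
  have fin: "finite {p. p permutes (UNIV :: 'n option set)}" by (rule finite_permutations) simp
  have "det A = (\<Sum>p | p permutes UNIV. ?t p)" by (simp add: det_def)
  also have "\<dots> = (\<Sum>p | p permutes range Some. ?t p)"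
  proof (rule sum.mono_neutral_right[OF fin])
    show "{p. p permutes range (Some :: 'n \<Rightarrow> _)} \<subseteq> {p. p permutes UNIV}"
      using permutes_subset by blast
    show "\<forall>p\<in>{p. p permutes UNIV} - {p. p permutes range (Some :: 'n \<Rightarrow> _)}. ?t p = 0"
    proof
      fix p assume p: "p \<in> {p. p permutes UNIV} - {p. p permutes range (Some :: 'n \<Rightarrow> 'n option)}"
      then have "p permutes UNIV" by simp
      then have "bij p" by (rule permutes_bij)
      have "p None \<noteq> None"
      proof
        assume "p None = None"
        then have "p x = x" if "x \<notin> range Some" for x
          using that by (metis notin_range_Some)
        moreover have "bij_betw p (range Some) (range Some)"
        proof -
          have eq: "range Some = UNIV - {None :: 'n option}" using notin_range_Some by blast
          show ?thesis unfolding eq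
            using bij_betw_DiffI[OF \<open>bij p\<close>, of "{None}" "{None}"] \<open>p None = None\<close> by (simp add: bij_betw_def)
        qed
        ultimately have "p permutes range Some" by (intro bij_imp_permutes) auto
        then show False using p by simp
      qed
      moreover obtain k where k: "p k = None" using \<open>bij p\<close> by (metis bij_pointE)
      ultimately obtain i where "k = Some i" by (cases k) auto
      then have "A $ k $ p k = 0" using assms k by simp
      then have "(\<Prod>k\<in>UNIV. A $ k $ p k) = 0" by (intro prod_zero) auto
      then show "?t p = 0" by simp
    qed
  qed
  also have "\<dots> = (\<Sum>q | q permutes (UNIV :: 'n set). ?t (?m q))"
  proof (rule sum.reindex_bij_witness[of _ "?m" "map_permutation (range Some) the"])
    have b2: "bij_betw the (range (Some :: 'n \<Rightarrow> _)) UNIV"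
      by (auto simp: bij_betw_def inj_on_def image_image)
    fix p :: "'n option \<Rightarrow> 'n option" assume "p \<in> {p. p permutes range Some}"
    then have p: "p permutes range Some" by simp
    show "map_permutation (range Some) the p \<in> {q. q permutes UNIV}"
      using map_permutation_permutes[OF b2 p] by simp
    show 1: "?m (map_permutation (range Some) the p) = p"
      by (rule map_permutation_compose_inv[OF b2 p]) auto
    show "?t (?m (map_permutation (range Some) the p)) = ?t p" by (simp only: 1)
  next
    have b1: "bij_betw Some UNIV (range (Some :: 'n \<Rightarrow> _))" by (auto simp: bij_betw_def)
    fix q :: "'n \<Rightarrow> 'n" assume "q \<in> {q. q permutes UNIV}"
    then have q: "q permutes UNIV" by simp
    show "?m q \<in> {p. p permutes range Some}"
      using map_permutation_permutes[OF b1 q] by simp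
    show "map_permutation (range Some) the (?m q) = q"
      by (rule map_permutation_compose_inv[OF b1 q]) auto
  qed
  also have "\<dots> = (\<Sum>q | q permutes (UNIV :: 'n set). of_int (sign q) * (\<Prod>k\<in>UNIV. A $ Some k $ Some (q k)))"
  proof (rule sum.cong[OF refl])
    fix q :: "'n \<Rightarrow> 'n" assume "q \<in> {q. q permutes UNIV}"
    then have q: "q permutes UNIV" by simp
    have s: "sign (?m q) = sign q" by (rule sign_map_permutation) (use q in auto)
    have a: "?m q (Some k) = Some (q k)" for k by (rule map_permutation_apply) auto
    have b: "?m q None = None" by (auto simp: map_permutation_def restrict_id_def)
    have "(\<Prod>k\<in>UNIV. A $ k $ ?m q k) = (\<Prod>k\<in>UNIV. A $ Some k $ Some (q k))"
      unfolding UNIV_option_conv by (subst prod.insert) (auto simp: a b assms prod.reindex)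
    then show "?t (?m q) = of_int (sign q) * (\<Prod>k\<in>UNIV. A $ Some k $ Some (q k))" by (simp add: s)
  qed
  also have "\<dots> = det (\<chi> i j. A $ Some i $ Some j)" by (simp add: det_def)
  finally show ?thesis .
qed

text \<open>Homogeneous coordinates. They turn affine relations between points into linear relations
  between vectors, see \<open>homog_eq_sum_iff\<close>.\<close>

definition homog :: "real ^ 'n \<Rightarrow> real ^ ('n option)" where
  "homog w = (\<chi> k. case k of None \<Rightarrow> 1 | Some k \<Rightarrow> w $ k)"

lemma homog_nth [simp]: "homog w $ None = 1" "homog w $ Some k = w $ k"
  by (simp_all add: homog_def)

lemma homog_eq_sum_iff:
  "homog p = (\<Sum>a\<in>A. c a *\<^sub>R homog (v a)) \<longleftrightarrow> sum c A = 1 \<and> p = (\<Sum>a\<in>A. c a *\<^sub>R v a)"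
  by (auto simp: vec_eq_iff split_option_all)

text \<open>Subtracting the first row from all others clears their entries in the column
  \<open>None\<close>, and \<open>det_option_block\<close> removes the first row and that
  column.\<close>

lemma ldet_homog:
  fixes ws :: "(real ^ 'n::{finite,linorder}) list"
  assumes "length ws = CARD('n)"
  shows "ldet (map homog (x # ws)) = ldet (map (\<lambda>w. w - x) ws)"
proof -
  have "ldet (homog x # us @ map homog ws) = ldet (homog x # us @ map (\<lambda>w. homog w - homog x) ws)"
    if "length us + length ws = CARD('n)" for us and ws :: "(real, 'n) vec list"
    using that
  proof (induction ws arbitrary: us)
    case (Cons w ws)
    have "ldet (homog x # us @ map homog (w # ws)) =
        ldet ((homog x # us) @ ((homog w - homog x) + homog x) # map homog ws)" by simp
    also have "\<dots> = ldet ((homog x # us) @ (homog w - homog x) # map homog ws)"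
      by (rule ldet_add_span) (use Cons.prems in \<open>auto intro: span_base\<close>)
    also have "\<dots> = ldet (homog x # us @ map (\<lambda>w. homog w - homog x) (w # ws))"
      using Cons.IH[of "us @ [homog w - homog x]"] Cons.prems by simp
    finally show ?case .
  qed simp
  from this[of "[]" ws] have "ldet (map homog (x # ws)) = ldet (homog x # map (\<lambda>w. homog w - homog x) ws)"
    using assms by simp
  also have "\<dots> = det (\<chi> i j. (\<chi> k. (homog x # map (\<lambda>w. homog w - homog x) ws) ! idx k) $ Some i $ Some j)"
    unfolding ldet_def
    by (rule det_option_block) (use assms idx_less[where 'm = 'n] in \<open>auto simp: idx_Some idx_None\<close>)
  also have "(\<chi> i j. (\<chi> k. (homog x # map (\<lambda>w. homog w - homog x) ws) ! idx k) $ Some i $ Some j) =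
      (\<chi> k::'n. map (\<lambda>w. w - x) ws ! idx k)"
    using assms idx_less[where 'm = 'n] by (auto simp: vec_eq_iff idx_Some)
  finally show ?thesis by (simp add: ldet_def)
qed

section \<open>Sums over increasing and Gale lists\<close>

text \<open>The recursive sums are suited to telescoping, the sets \<open>increasing_lists\<close>
  and \<open>gale_lists\<close> to geometry; \<open>sum_increasing_lists\<close> and
  \<open>sum_gale_lists\<close> connect them.\<close>

fun increasing_sum :: "nat \<Rightarrow> nat \<Rightarrow> nat \<Rightarrow> (nat list \<Rightarrow> real) \<Rightarrow> real" where
  "increasing_sum N q 0 G = G []"
| "increasing_sum N q (Suc m) G = (\<Sum>k\<in>{q..<N}. increasing_sum N (Suc k) m (\<lambda>l. G (k # l)))"

text \<open>Lists of adjacent pairs, followed by \<open>N\<close> when the length is odd. Here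
  \<open>N\<close> itself may occur, since the entries are the vertices \<open>0\<close> to
  \<open>N\<close>, whereas \<open>increasing_sum\<close> indexes the \<open>N\<close> increments
  between them.\<close>

fun gale_sum :: "nat \<Rightarrow> nat \<Rightarrow> nat \<Rightarrow> (nat list \<Rightarrow> real) \<Rightarrow> real" where
  "gale_sum N q 0 G = G []"
| "gale_sum N q (Suc 0) G = (if q \<le> N then G [N] else 0)"
| "gale_sum N q (Suc (Suc m)) G = (\<Sum>b\<in>{q..<N}. gale_sum N (b + 2) m (\<lambda>l. G (b # Suc b # l)))"

definition increasing_lists :: "nat \<Rightarrow> nat \<Rightarrow> nat \<Rightarrow> nat list set" where
  "increasing_lists N q m = {l. sorted_wrt (<) l \<and> length l = m \<and> set l \<subseteq> {q..<N}}"

text \<open>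
  Gale's evenness condition. It characterises the facets on one side of a cyclic polytope one
  dimension higher, and their projections triangulate the given one.
\<close>

definition gale_lists :: "nat \<Rightarrow> nat \<Rightarrow> nat \<Rightarrow> nat list set" where
  "gale_lists N q m = {l \<in> increasing_lists (Suc N) q m.
     \<forall>j\<in>{q..N} - set l. even (length (filter (\<lambda>a. a < j) l))}"

lemma finite_increasing_lists: "finite (increasing_lists N q m)"
  by (rule finite_subset[OF _ finite_lists_length_eq[of "{q..<N}" m]]) (auto simp: increasing_lists_def)

lemma finite_gale_lists: "finite (gale_lists N q m)"
  unfolding gale_lists_def using finite_increasing_lists by simp

lemma increasing_lists_0: "increasing_lists N q 0 = {[]}"
  by (auto simp: increasing_lists_def)

lemma increasing_lists_Suc:
  "increasing_lists N q (Suc m) = (\<Union>k\<in>{q..<N}. (#) k ` increasing_lists N (Suc k) m)"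
  by (fastforce simp: increasing_lists_def length_Suc_conv image_iff)

lemma sum_increasing_lists: "(\<Sum>l\<in>increasing_lists N q m. G l) = increasing_sum N q m G"
proof (induction m arbitrary: q G)
  case (Suc m)
  have "(\<Sum>l\<in>increasing_lists N q (Suc m). G l) = (\<Sum>k\<in>{q..<N}. sum G ((#) k ` increasing_lists N (Suc k) m))"
    unfolding increasing_lists_Suc by (rule sum.UNION_disjoint) (auto simp: finite_increasing_lists)
  then show ?case by (simp add: sum.reindex Suc.IH)
qed (simp add: increasing_lists_0)

lemma gale_lists_1: "gale_lists N q (Suc 0) = (if q \<le> N then {[N]} else {})"
proof (rule set_eqI)
  fix l show "l \<in> gale_lists N q (Suc 0) \<longleftrightarrow> l \<in> (if q \<le> N then {[N]} else {})"
  proof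
    assume l: "l \<in> gale_lists N q (Suc 0)"
    then obtain a where a: "l = [a]" "q \<le> a" "a \<le> N"
      by (auto simp: gale_lists_def increasing_lists_def length_Suc_conv)
    have gale: "\<forall>j\<in>{q..N} - set l. even (length (filter (\<lambda>a. a < j) l))"
      using l unfolding gale_lists_def by blast
    \<comment> \<open>Otherwise \<open>N\<close> is a gap with exactly one entry below it.\<close>
    have "a = N"
    proof (rule ccontr)
      assume "a \<noteq> N"
      then have "even (length (filter (\<lambda>a. a < N) l))" using a by (intro bspec[OF gale]) auto
      then show False using a \<open>a \<noteq> N\<close> by simp
    qed
    then show "l \<in> (if q \<le> N then {[N]} else {})" using a by simp
  qed (auto simp: gale_lists_def increasing_lists_def split: if_splits)
qed

text \<open>If the second entry were not the successor of the first entry \<open>b\<close>, then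
  \<open>Suc b\<close> would be a gap with one entry below it. Removing an adjacent pair lowers the
  counts at later gaps by two, so the condition passes to the rest and back.\<close>

lemma gale_lists_Suc_Suc:
  "gale_lists N q (Suc (Suc m)) = (\<Union>b\<in>{q..<N}. (\<lambda>l. b # Suc b # l) ` gale_lists N (b + 2) m)"
proof (rule set_eqI)
  fix l
  show "l \<in> gale_lists N q (Suc (Suc m)) \<longleftrightarrow> l \<in> (\<Union>b\<in>{q..<N}. (\<lambda>l. b # Suc b # l) ` gale_lists N (b + 2) m)"
  proof
    assume l: "l \<in> gale_lists N q (Suc (Suc m))"
    then obtain b c k where k: "l = b # c # k" by (auto simp: gale_lists_def increasing_lists_def length_Suc_conv)
    have bc: "q \<le> b" "b < c" "c \<le> N" "\<forall>x\<in>set k. c < x \<and> x \<le> N" "sorted_wrt (<) k" "length k = m"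
      using l by (auto simp: k gale_lists_def increasing_lists_def)
    have gale: "\<forall>j\<in>{q..N} - set l. even (length (filter (\<lambda>a. a < j) l))"
      using l unfolding gale_lists_def by blast
    have c: "c = Suc b"
    proof (rule ccontr)
      assume "c \<noteq> Suc b"
      then have "Suc b \<in> {q..N} - set l" using bc by (auto simp: k)
      then have "even (length (filter (\<lambda>a. a < Suc b) l))" by (rule bspec[OF gale])
      moreover have "filter (\<lambda>a. a < Suc b) k = []" using bc by (auto simp: filter_empty_conv)
      ultimately show False using bc by (simp add: k)
    qed
    have "even (length (filter (\<lambda>a. a < j) k))" if j: "j \<in> {b + 2..N} - set k" for j
    proof -
      have "even (length (filter (\<lambda>a. a < j) l))" using j bc c by (intro bspec[OF gale]) (auto simp: k)
      then show ?thesis using j c by (simp add: k)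
    qed
    then have "k \<in> gale_lists N (b + 2) m"
      using bc c by (auto simp: gale_lists_def increasing_lists_def)
    then show "l \<in> (\<Union>b\<in>{q..<N}. (\<lambda>l. b # Suc b # l) ` gale_lists N (b + 2) m)"
      using bc c k by auto
  next
    assume "l \<in> (\<Union>b\<in>{q..<N}. (\<lambda>l. b # Suc b # l) ` gale_lists N (b + 2) m)"
    then obtain b k where b: "q \<le> b" "b < N" "l = b # Suc b # k" and k: "k \<in> gale_lists N (b + 2) m" by auto
    have ks: "\<forall>x\<in>set k. b + 2 \<le> x \<and> x \<le> N" "sorted_wrt (<) k" "length k = m"
      using k by (auto simp: gale_lists_def increasing_lists_def)
    have "even (length (filter (\<lambda>a. a < j) l))" if j: "j \<in> {q..N} - set l" for j
    proof (cases "j < b")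
      case True
      then have "filter (\<lambda>a. a < j) k = []" using ks by (auto simp: filter_empty_conv)
      then show ?thesis using True by (simp add: b)
    next
      case False
      then have "j \<in> {b + 2..N} - set k" using j b by auto
      then have "even (length (filter (\<lambda>a. a < j) k))" using k by (auto simp: gale_lists_def)
      then show ?thesis using False j b by auto
    qed
    then show "l \<in> gale_lists N q (Suc (Suc m))"
      using b ks by (auto simp: gale_lists_def increasing_lists_def)
  qed
qed

lemma sum_gale_lists: "(\<Sum>l\<in>gale_lists N q m. G l) = gale_sum N q m G"
proof (induction N q m G rule: gale_sum.induct)
  case (1 N q G)
  have "gale_lists N q 0 = {[]}" by (auto simp: gale_lists_def increasing_lists_def)
  then show ?case by simp
next
  case (2 N q G)
  then show ?case by (simp add: gale_lists_1)
next
  case (3 N q m G)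
  have "(\<Sum>l\<in>gale_lists N q (Suc (Suc m)). G l) =
      (\<Sum>b\<in>{q..<N}. sum G ((\<lambda>l. b # Suc b # l) ` gale_lists N (b + 2) m))"
    unfolding gale_lists_Suc_Suc by (rule sum.UNION_disjoint) (auto simp: finite_gale_lists)
  also have "\<dots> = (\<Sum>b\<in>{q..<N}. \<Sum>l\<in>gale_lists N (b + 2) m. G (b # Suc b # l))"
    by (rule sum.cong[OF refl]) (simp add: sum.reindex inj_on_def)
  also have "\<dots> = gale_sum N q (Suc (Suc m)) G" using 3 by simp
  finally show ?case .
qed

lemma gale_sum_sum: "finite A \<Longrightarrow> (\<Sum>i\<in>A. gale_sum N q m (G i)) = gale_sum N q m (\<lambda>l. \<Sum>i\<in>A. G i l)"
  by (simp flip: sum_gale_lists) (rule sum.swap)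

text \<open>Makes the smaller index the inner one, so that it can telescope.\<close>

lemma sum_swap_less:
  "(\<Sum>k\<in>{q..<N::nat}. \<Sum>b\<in>{Suc k..<N}. f k b) = (\<Sum>b\<in>{Suc q..<N}. \<Sum>k\<in>{q..<b}. f k b :: 'a::comm_monoid_add)"
proof -
  have "(\<Sum>k\<in>{q..<N}. \<Sum>b\<in>{Suc k..<N}. f k b) = (\<Sum>(k, b)\<in>(SIGMA k:{q..<N}. {Suc k..<N}). f k b)"
    by (simp add: sum.Sigma)
  also have "\<dots> = (\<Sum>(b, k)\<in>(SIGMA b:{Suc q..<N}. {q..<b}). f k b)"
    by (rule sum.reindex_bij_witness[of _ "\<lambda>(a, b). (b, a)" "\<lambda>(a, b). (b, a)"]) auto
  also have "\<dots> = (\<Sum>b\<in>{Suc q..<N}. \<Sum>k\<in>{q..<b}. f k b)"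
    by (simp add: sum.Sigma)
  finally show ?thesis .
qed

text \<open>
  Every second summation index runs freely between its neighbours, so the increments it carries
  telescope.
\<close>

lemma increasing_sum_ldet_eq_gale_sum_aux:
  fixes v :: "nat \<Rightarrow> real ^ 'm::{finite,linorder}"
  assumes "length us + m = CARD('m)" "q \<le> N"
  shows "increasing_sum N q m (\<lambda>l. ldet (us @ map (\<lambda>k. v (Suc k) - v k) l)) =
         gale_sum N (Suc q) m (\<lambda>l. ldet (us @ cdiffs (map v (q # l))))"
  using assms
proof (induction m arbitrary: us q rule: induct_nat_012)
  case 1
  have lin: "linear (\<lambda>c. ldet (us @ [c]))" by (rule linear_ldet) (use 1 in simp)
  have "(\<Sum>k\<in>{q..<N}. ldet (us @ [v (Suc k) - v k])) = ldet (us @ [v N - v q])"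
    using sum_Suc_diff'[of q N v] 1 by (simp add: linear_sum[OF lin, symmetric])
  \<comment> \<open>For the case \<open>q = N\<close>, where \<open>gale_sum\<close> starts at
    \<open>Suc N\<close> and is \<open>0\<close>.\<close>
  moreover have "ldet (us @ [v N - v N]) = 0" using linear_0[OF lin] by simp
  ultimately show ?case using 1 by (cases "q = N") auto
next
  case (ge2 m)
  let ?d = "\<lambda>k. v (Suc k) - v k"
  have "increasing_sum N q (Suc (Suc m)) (\<lambda>l. ldet (us @ map ?d l)) =
      (\<Sum>k\<in>{q..<N}. \<Sum>b\<in>{Suc k..<N}. increasing_sum N (Suc b) m (\<lambda>l. ldet ((us @ [?d k, ?d b]) @ map ?d l)))"
    by simp
  also have "\<dots> = (\<Sum>k\<in>{q..<N}. \<Sum>b\<in>{Suc k..<N}.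
      gale_sum N (Suc (Suc b)) m (\<lambda>l. ldet ((us @ [?d k, ?d b]) @ cdiffs (map v (Suc b # l)))))"
    by (intro sum.cong refl ge2.IH(1)) (use ge2.prems in auto)
  also have "\<dots> = (\<Sum>b\<in>{Suc q..<N}. \<Sum>k\<in>{q..<b}.
      gale_sum N (Suc (Suc b)) m (\<lambda>l. ldet ((us @ [?d k, ?d b]) @ cdiffs (map v (Suc b # l)))))"
    by (rule sum_swap_less)
  also have "\<dots> = (\<Sum>b\<in>{Suc q..<N}. gale_sum N (b + 2) m (\<lambda>l. ldet (us @ cdiffs (map v (q # b # Suc b # l)))))"
  proof (rule sum.cong[OF refl])
    fix b assume b: "b \<in> {Suc q..<N}"
    have lin: "linear (\<lambda>c. ldet (us @ c # ys))" for ys by (rule linear_ldet) (use ge2.prems in simp)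
    have "(\<Sum>k\<in>{q..<b}. ldet ((us @ [?d k, ?d b]) @ cdiffs (map v (Suc b # l)))) =
        ldet (us @ cdiffs (map v (q # b # Suc b # l)))" for l
      using sum_Suc_diff'[of q b v] b by (simp add: linear_sum[OF lin, symmetric])
    then show "(\<Sum>k\<in>{q..<b}. gale_sum N (Suc (Suc b)) m (\<lambda>l. ldet ((us @ [?d k, ?d b]) @ cdiffs (map v (Suc b # l))))) =
        gale_sum N (b + 2) m (\<lambda>l. ldet (us @ cdiffs (map v (q # b # Suc b # l))))"
      by (simp only: gale_sum_sum finite_atLeastLessThan add_2_eq_Suc')
  qed
  finally show ?case by simp
qed simp

text \<open>The first index \<open>k\<close> does not telescope: its increment is the edge from
  \<open>k\<close> to \<open>Suc k\<close>, the leading pair of a Gale list. The remaining indices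
  are handled by the auxiliary lemma with \<open>q = Suc k\<close>.\<close>

lemma increasing_sum_ldet_eq_gale_sum:
  fixes v :: "nat \<Rightarrow> real ^ 'm::{finite,linorder}"
  shows "increasing_sum N 0 CARD('m) (\<lambda>l. ldet (map (\<lambda>k. v (Suc k) - v k) l)) =
         gale_sum N 0 (Suc CARD('m)) (\<lambda>l. ldet (cdiffs (map v l)))"
proof -
  obtain m where m: "CARD('m) = Suc m" using not0_implies_Suc[of "CARD('m)"] by auto
  have "increasing_sum N (Suc k) m (\<lambda>l. ldet ([v (Suc k) - v k] @ map (\<lambda>k. v (Suc k) - v k) l)) =
      gale_sum N (Suc (Suc k)) m (\<lambda>l. ldet ([v (Suc k) - v k] @ cdiffs (map v (Suc k # l))))"
    if "k \<in> {0..<N}" for k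
    by (rule increasing_sum_ldet_eq_gale_sum_aux) (use that m in auto)
  then show ?thesis by (simp add: m)
qed

section \<open>Volume of a simplex\<close>

text \<open>The library computes simplex volumes only for well-ordered index types.\<close>

typedef 'a wo_copy = "UNIV :: 'a set" by simp


instantiation wo_copy :: ("{finite,linorder}") "{finite,wellorder}"
begin

definition less_eq_wo_copy :: "'a wo_copy \<Rightarrow> 'a wo_copy \<Rightarrow> bool" where
  "less_eq_wo_copy x y \<longleftrightarrow> Rep_wo_copy x \<le> Rep_wo_copy y"

definition less_wo_copy :: "'a wo_copy \<Rightarrow> 'a wo_copy \<Rightarrow> bool" where
  "less_wo_copy x y \<longleftrightarrow> Rep_wo_copy x < Rep_wo_copy y"

instance
proof
  note defs = less_eq_wo_copy_def less_wo_copy_def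
  have "(UNIV :: 'a wo_copy set) = range Abs_wo_copy"
    using surjI[of Abs_wo_copy Rep_wo_copy, OF Rep_wo_copy_inverse] by (rule sym)
  then show "finite (UNIV :: 'a wo_copy set)" by (rule ssubst) simp
  show "(x < y) = (x \<le> y \<and> \<not> y \<le> x)" for x y :: "'a wo_copy" by (auto simp: defs)
  show "x \<le> x" for x :: "'a wo_copy" by (auto simp: defs)
  show "x \<le> y \<Longrightarrow> y \<le> z \<Longrightarrow> x \<le> z" for x y z :: "'a wo_copy" by (auto simp: defs)
  show "x \<le> y \<Longrightarrow> y \<le> x \<Longrightarrow> x = y" for x y :: "'a wo_copy" by (auto simp: defs Rep_wo_copy_inject)
  show "x \<le> y \<or> y \<le> x" for x y :: "'a wo_copy" by (auto simp: defs)
  fix P :: "'a wo_copy \<Rightarrow> bool" and a :: "'a wo_copy"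
  assume step: "\<And>x. (\<And>y. y < x \<Longrightarrow> P y) \<Longrightarrow> P x"
  show "P a"
  proof (induction a rule: measure_induct_rule[of "\<lambda>x. card {..<Rep_wo_copy x}"])
    case (less x)
    show ?case
    proof (rule step)
      fix y assume "y < x"
      then have "card {..<Rep_wo_copy y} < card {..<Rep_wo_copy x}"
        by (intro psubset_card_mono) (auto simp: defs)
      then show "P y" by (rule less)
    qed
  qed
qed

end

lemma bij_Rep_wo_copy: "bij Rep_wo_copy"
  by (intro bijI injI surjI[of _ Abs_wo_copy]) (simp_all add: Rep_wo_copy_inject Abs_wo_copy_inverse)

lemma prod_Basis_cart:
  fixes f :: "real ^ 'n \<Rightarrow> 'b::comm_monoid_mult"
  shows "(\<Prod>b\<in>Basis. f b) = (\<Prod>k\<in>UNIV. f (axis k 1))"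
proof -
  have "inj_on (\<lambda>k::'n. axis k (1::real)) UNIV" by (rule injI) (simp add: axis_eq_axis)
  then have "prod f (range (\<lambda>k::'n. axis k 1)) = (\<Prod>k\<in>UNIV. f (axis k 1))"
    by (simp only: prod.reindex o_def)
  moreover have "Basis = range (\<lambda>k::'n. axis k (1::real))" by (auto simp: Basis_vec_def)
  ultimately show ?thesis by (simp only:)
qed

definition to_wo :: "(real, 'n::{finite,linorder}) vec \<Rightarrow> (real, 'n wo_copy) vec" where
  "to_wo x = (\<chi> k. x $ Rep_wo_copy k)"

lemma to_wo_nth [simp]: "to_wo x $ k = x $ Rep_wo_copy k"
  by (simp add: to_wo_def)

lemma linear_to_wo: "linear to_wo"
  by (rule linearI) (simp_all add: vec_eq_iff)

lemma measurable_to_wo [measurable]: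
  "to_wo \<in> borel_measurable (borel :: (real ^ 'n::{finite,linorder}) measure)"
  by (intro borel_measurable_continuous_onI linear_continuous_on linear_conv_bounded_linear[THEN iffD1] linear_to_wo)

text \<open>Renaming coordinates maps boxes to boxes with the same side lengths, and the values on
  boxes determine \<open>lborel\<close>.\<close>

lemma lborel_to_wo: "lborel = distr lborel borel (to_wo :: real ^ 'n::{finite,linorder} \<Rightarrow> _)"
proof (rule lborel_eqI)
  fix l u :: "real ^ 'n wo_copy" assume lu: "\<And>b. b \<in> Basis \<Longrightarrow> l \<bullet> b \<le> u \<bullet> b"
  define f where "f = (\<lambda>x :: real ^ 'n wo_copy. (\<chi> k. x $ Abs_wo_copy k) :: (real, 'n) vec)"
  have lu': "l $ k \<le> u $ k" for k
    using lu[of "axis k 1"] by (auto simp: Basis_vec_def inner_axis)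
  have "to_wo -` box l u = box (f l) (f u)"
  proof (rule set_eqI)
    fix x
    have "(\<forall>k. l $ k < x $ Rep_wo_copy k \<and> x $ Rep_wo_copy k < u $ k) \<longleftrightarrow>
        (\<forall>i. l $ Abs_wo_copy i < x $ i \<and> x $ i < u $ Abs_wo_copy i)"
      by (metis Abs_wo_copy_inverse Rep_wo_copy_inverse UNIV_I)
    then show "x \<in> to_wo -` box l u \<longleftrightarrow> x \<in> box (f l) (f u)"
      by (simp add: mem_box_cart f_def)
  qed
  then have "emeasure (distr lborel borel to_wo) (box l u) = emeasure lborel (box (f l) (f u))"
    by (subst emeasure_distr) auto
  also have "\<dots> = ennreal (\<Prod>b\<in>Basis. (f u - f l) \<bullet> b)"
    by (intro emeasure_lborel_box) (auto simp: Basis_vec_def inner_axis f_def lu')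
  also have "(\<Prod>b\<in>Basis. (f u - f l) \<bullet> b) = (\<Prod>k\<in>UNIV. u $ Abs_wo_copy k - l $ Abs_wo_copy k)"
    unfolding prod_Basis_cart by (simp add: inner_axis f_def)
  also have "\<dots> = (\<Prod>k\<in>UNIV. u $ k - l $ k)"
    by (rule prod.reindex_bij_witness[of _ Rep_wo_copy Abs_wo_copy]) (auto simp: Rep_wo_copy_inverse Abs_wo_copy_inverse)
  also have "\<dots> = (\<Prod>b\<in>Basis. (u - l) \<bullet> b)"
    unfolding prod_Basis_cart by (simp add: inner_axis)
  finally show "emeasure (distr lborel borel to_wo) (box l u) = ennreal (\<Prod>b\<in>Basis. (u - l) \<bullet> b)" .
qed simp

text \<open>Conjugation by \<open>f\<close> matches the terms of the two Leibniz sums and preserves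
  signs.\<close>

lemma det_reindex:
  fixes A :: "((real, 'n::finite) vec, 'n) vec" and f :: "'m::finite \<Rightarrow> 'n"
  assumes f: "bij f"
  shows "det (\<chi> i j. A $ f i $ f j) = det A"
proof -
  have "det (\<chi> i j. A $ f i $ f j) = (\<Sum>p | p permutes UNIV. of_int (sign p) * (\<Prod>k\<in>UNIV. A $ f k $ f (p k)))"
    by (simp add: det_def)
  also have "\<dots> = (\<Sum>q | q permutes UNIV. of_int (sign q) * (\<Prod>k\<in>UNIV. A $ k $ q k))"
  proof (rule sum.reindex_bij_witness[of _ "map_permutation UNIV (inv f)" "map_permutation UNIV f"])
    have b: "bij_betw f UNIV UNIV" "bij_betw (inv f) UNIV UNIV" using f by (auto intro: bij_imp_bij_inv)
    have i: "inv f (f x) = x" "f (inv f y) = y" for x y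
      using f by (simp_all add: bij_is_inj bij_is_surj surj_f_inv_f)
    show "map_permutation UNIV f p \<in> {q. q permutes UNIV}" if "p \<in> {p. p permutes UNIV}" for p
      using that map_permutation_permutes[OF b(1)] by simp
    show "map_permutation UNIV (inv f) q \<in> {q. q permutes UNIV}" if "q \<in> {p. p permutes UNIV}" for q
      using that map_permutation_permutes[OF b(2)] by simp
    show "map_permutation UNIV (inv f) (map_permutation UNIV f p) = p" if "p \<in> {p. p permutes UNIV}" for p
      using that by (intro map_permutation_compose_inv[OF b(1)]) (auto simp: i)
    show "map_permutation UNIV f (map_permutation UNIV (inv f) q) = q" if "q \<in> {p. p permutes UNIV}" for q
      using that by (intro map_permutation_compose_inv[OF b(2)]) (auto simp: i)
    fix p :: "'m \<Rightarrow> 'm" assume "p \<in> {p. p permutes UNIV}"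
    then have p: "p permutes UNIV" by simp
    have a: "map_permutation UNIV f p (f k) = f (p k)" for k
      using f by (intro map_permutation_apply) (auto simp: bij_is_inj)
    have "(\<Prod>k\<in>UNIV. A $ k $ map_permutation UNIV f p k) = (\<Prod>k\<in>UNIV. A $ f k $ f (p k))"
      by (rule prod.reindex_bij_witness[of _ f "inv f"]) (auto simp: i simp flip: a)
    moreover have "sign (map_permutation UNIV f p) = sign p"
      using f p by (intro sign_map_permutation) (auto simp: bij_is_inj)
    ultimately show "of_int (sign (map_permutation UNIV f p)) * (\<Prod>k\<in>UNIV. A $ k $ map_permutation UNIV f p k)
        = of_int (sign p) * (\<Prod>k\<in>UNIV. A $ f k $ f (p k))" by simp
  qed
  also have "\<dots> = det A" by (simp add: det_def)
  finally show ?thesis .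
qed

lemma measure_simplex_linorder:
  fixes X :: "(real ^ 'n::{finite,linorder}) set" and f :: "'n \<Rightarrow> (real, 'n) vec"
  assumes "finite X" "card X = Suc CARD('n)" and x0: "x0 \<in> X" and bij: "bij_betw f UNIV (X - {x0})"
  shows "measure lebesgue (convex hull X) = \<bar>det (\<chi> i. f i - x0)\<bar> / fact CARD('n)"
proof -
  define to' :: "(real, 'n) vec \<Rightarrow> (real, 'n wo_copy) vec" where "to' = to_wo"
  have inj: "inj to'"
  proof (rule injI)
    fix x y assume "to' x = to' y"
    then have "x $ Rep_wo_copy k = y $ Rep_wo_copy k" for k
      by (metis to'_def to_wo_nth)
    from this[of "Abs_wo_copy _"] show "x = y" by (simp add: vec_eq_iff Abs_wo_copy_inverse)
  qed
  have lin: "linear to'" unfolding to'_def by (rule linear_to_wo)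
  have cX: "compact (convex hull X)" using assms(1) by (rule finite_imp_compact_convex_hull)
  have cX': "compact (convex hull (to' ` X))"
    using assms(1) by (intro finite_imp_compact_convex_hull) auto
  have "to' -` (convex hull (to' ` X)) = convex hull X"
    using inj convex_hull_linear_image[OF lin, of X] by (metis inj_vimage_image_eq)
  moreover have "measure lborel (convex hull (to' ` X)) = measure (distr lborel borel to') (convex hull (to' ` X))"
    unfolding to'_def lborel_to_wo[symmetric] ..
  ultimately have 1: "measure lborel (convex hull (to' ` X)) = measure lborel (convex hull X)"
    using cX' by (subst (asm) measure_distr) (auto simp: to'_def borel_compact)
  have cardN: "CARD('n wo_copy) = CARD('n)"
    using bij_betw_same_card[OF bij_Rep_wo_copy] by simp
  have "measure lborel (convex hull (to' ` X)) =
      \<bar>det (\<chi> i j. (to' \<circ> f \<circ> Rep_wo_copy) j $ i - to' x0 $ i)\<bar> / fact CARD('n wo_copy)"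
  proof (rule content_simplex)
    show "card (to' ` X) = Suc CARD('n wo_copy)"
      using assms inj cardN by (simp add: card_image inj_on_subset)
    have "bij_betw (to' \<circ> (f \<circ> Rep_wo_copy)) UNIV (to' ` (X - {x0}))"
      using inj by (intro bij_betw_trans[OF bij_betw_trans[OF bij_Rep_wo_copy bij]])
        (auto simp: bij_betw_def intro: inj_on_subset)
    moreover have "to' ` (X - {x0}) = to' ` X - {to' x0}" using inj by (auto simp: inj_def)
    ultimately show "bij_betw (to' \<circ> f \<circ> Rep_wo_copy) UNIV (to' ` X - {to' x0})"
      by (simp add: comp_assoc)
  qed (use assms in auto)
  \<comment> \<open>In \<open>content_simplex\<close> the edge vectors are columns, here they are
    rows.\<close>
  also have "(\<chi> i j. (to' \<circ> f \<circ> Rep_wo_copy) j $ i - to' x0 $ i) =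
      transpose (\<chi> i j. (\<chi> i. f i - x0) $ Rep_wo_copy i $ Rep_wo_copy j)"
    by (simp add: vec_eq_iff transpose_def to'_def)
  also have "det \<dots> = det (\<chi> i. f i - x0)"
    unfolding det_transpose by (rule det_reindex[OF bij_Rep_wo_copy])
  finally show ?thesis
    using cX by (simp add: 1 cardN measure_completion borel_compact)
qed

section \<open>Triangulating the convex hull\<close>

text \<open>The weight of index \<open>0\<close> is chosen so large that it outweighs the tail of
  every vector with \<open>g 0 > 0\<close>. The vectors with \<open>g 0 = 0\<close> are left to the
  tail weights, which the induction hypothesis provides. Finiteness of \<open>F\<close> makes one
  weight large enough for all.\<close>

lemma lexicographically_positive_functional:
  fixes F :: "(nat \<Rightarrow> real) set"
  assumes "finite F" "\<And>g. g \<in> F \<Longrightarrow> \<exists>i\<le>N. 0 < g i \<and> (\<forall>l<i. g l = 0)"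
  shows "\<exists>f. \<forall>g\<in>F. 0 < (\<Sum>i\<le>N. g i * f i)"
  using assms
proof (induction N arbitrary: F)
  case 0
  then show ?case by (intro exI[of _ "\<lambda>_. 1"]) auto
next
  case (Suc N)
  define F0 where "F0 = (\<lambda>g i. g (Suc i)) ` {g \<in> F. g 0 = 0}"
  have "\<exists>f. \<forall>g\<in>F0. 0 < (\<Sum>i\<le>N. g i * f i)"
  proof (rule Suc.IH)
    show "finite F0" using Suc.prems by (simp add: F0_def)
    fix h assume "h \<in> F0"
    then obtain g where g: "g \<in> F" "g 0 = 0" "h = (\<lambda>i. g (Suc i))" by (auto simp: F0_def)
    then obtain i where i: "i \<le> Suc N" "0 < g i" "\<forall>l<i. g l = 0" using Suc.prems(2) by blast
    then obtain k where "i = Suc k" using g by (cases i) auto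
    then show "\<exists>i\<le>N. 0 < h i \<and> (\<forall>l<i. h l = 0)" using i g by auto
  qed
  then obtain f where f: "\<And>h. h \<in> F0 \<Longrightarrow> 0 < (\<Sum>i\<le>N. h i * f i)" by blast
  define S where "S g = (\<Sum>i\<le>N. g (Suc i) * f i)" for g
  \<comment> \<open>The sum is at least each of its summands, so \<open>c\<close> exceeds
    \<open>\<bar>S g\<bar> / g 0\<close> for every \<open>g\<close> concerned.\<close>
  define c where "c = 1 + (\<Sum>g\<in>{g \<in> F. 0 < g 0}. \<bar>S g\<bar> / g 0)"
  have "0 < (\<Sum>i\<le>Suc N. g i * (case i of 0 \<Rightarrow> c | Suc k \<Rightarrow> f k))" if g: "g \<in> F" for g
  proof -
    have sum: "(\<Sum>i\<le>Suc N. g i * (case i of 0 \<Rightarrow> c | Suc k \<Rightarrow> f k)) = g 0 * c + S g"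
      by (simp add: sum.atMost_Suc_shift S_def del: sum.atMost_Suc)
    obtain i where i: "0 < g i" "\<forall>l<i. g l = 0" using Suc.prems(2) g by blast
    show ?thesis
    proof (cases "0 < g 0")
      case True
      have "\<bar>S g\<bar> / g 0 \<le> (\<Sum>g\<in>{g \<in> F. 0 < g 0}. \<bar>S g\<bar> / g 0)"
        using Suc.prems(1) g True by (intro member_le_sum) auto
      then have "\<bar>S g\<bar> / g 0 < c" by (simp add: c_def)
      then have "\<bar>S g\<bar> < g 0 * c" using True by (simp add: divide_less_eq mult.commute)
      then show ?thesis unfolding sum by linarith
    next
      case False
      then have "g 0 = 0" using i by (cases i) auto
      then have "(\<lambda>i. g (Suc i)) \<in> F0" using g by (auto simp: F0_def)
      from f[OF this] show ?thesis unfolding sum using \<open>g 0 = 0\<close> by (simp add: S_def)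
    qed
  qed
  then show ?case by blast
qed

text \<open>The weights are attached to indices, not to points, so that \<open>v\<close> may repeat
  values and vertices can be exchanged by index.\<close>

lemma convex_hull_image_iff:
  assumes "finite A"
  shows "p \<in> convex hull (v ` A) \<longleftrightarrow> (\<exists>u. (\<forall>a\<in>A. 0 \<le> u a) \<and> sum u A = (1::real) \<and> p = (\<Sum>a\<in>A. u a *\<^sub>R v a))"
proof
  let ?S = "{p. \<exists>u. (\<forall>a\<in>A. 0 \<le> u a) \<and> sum u A = (1::real) \<and> p = (\<Sum>a\<in>A. u a *\<^sub>R v a)}"
  have "convex hull (v ` A) \<subseteq> ?S"
  proof (rule hull_minimal)
    show "v ` A \<subseteq> ?S"
    proof clarify
      fix a assume "a \<in> A"
      then show "\<exists>u. (\<forall>a\<in>A. 0 \<le> u a) \<and> sum u A = (1::real) \<and> v a = (\<Sum>a\<in>A. u a *\<^sub>R v a)"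
        using assms by (intro exI[of _ "\<lambda>b. if b = a then 1 else 0"]) (auto simp: if_distrib if_distribR cong: if_cong)
    qed
    show "convex ?S"
    proof (rule convexI, clarify)
      fix s t :: real and u w :: "'a \<Rightarrow> real"
      assume *: "0 \<le> s" "0 \<le> t" "s + t = 1" "\<forall>a\<in>A. 0 \<le> u a" "sum u A = 1" "\<forall>a\<in>A. 0 \<le> w a" "sum w A = 1"
      show "\<exists>r. (\<forall>a\<in>A. 0 \<le> r a) \<and> sum r A = 1 \<and>
        s *\<^sub>R (\<Sum>a\<in>A. u a *\<^sub>R v a) + t *\<^sub>R (\<Sum>a\<in>A. w a *\<^sub>R v a) = (\<Sum>a\<in>A. r a *\<^sub>R v a)"
        by (intro exI[of _ "\<lambda>a. s * u a + t * w a"])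
           (use * in \<open>auto simp: sum.distrib scaleR_left_distrib scaleR_sum_right simp flip: sum_distrib_left\<close>)
    qed
  qed
  then show "p \<in> convex hull (v ` A) \<Longrightarrow> \<exists>u. (\<forall>a\<in>A. 0 \<le> u a) \<and> sum u A = (1::real) \<and> p = (\<Sum>a\<in>A. u a *\<^sub>R v a)"
    by blast
  assume "\<exists>u. (\<forall>a\<in>A. 0 \<le> u a) \<and> sum u A = (1::real) \<and> p = (\<Sum>a\<in>A. u a *\<^sub>R v a)"
  then obtain u where u: "\<forall>a\<in>A. 0 \<le> u a" "sum u A = (1::real)" "p = (\<Sum>a\<in>A. u a *\<^sub>R v a)" by blast
  show "p \<in> convex hull (v ` A)"
    unfolding u(3) by (rule convex_sum[OF assms convex_convex_hull]) (use u in \<open>auto intro: hull_inc\<close>)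
qed

lemma sorted_wrt_filter_split:
  "sorted_wrt (<) l \<Longrightarrow> filter (\<lambda>a. a < j) l @ filter (\<lambda>a. \<not> a < j) l = (l :: 'a::linorder list)"
proof (induction l)
  case (Cons a l)
  show ?case
  proof (cases "a < j")
    case False
    then have "filter (\<lambda>a. a < j) l = []" using Cons.prems by (auto simp: filter_empty_conv)
    then show ?thesis using Cons False by simp
  qed (use Cons in simp)
qed simp

section \<open>Gale triangulation of points with positive ordered determinants\<close>

context
  fixes v :: "nat \<Rightarrow> real ^ 'n::{finite,linorder}" and N :: nat
  assumes pos: "\<And>l. l \<in> increasing_lists (Suc N) 0 (Suc CARD('n)) \<Longrightarrow> 0 < ldet (map (\<lambda>i. homog (v i)) l)"
begin

abbreviation (input) "V i \<equiv> homog (v i)"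

text \<open>
  The heights \<open>f\<close> lift the points to one dimension higher, and \<open>z l\<close> is the hyperplane through the
  lifted vertices of the simplex \<open>l\<close>. The last clause says that a lifted point lies above or below
  this hyperplane according to the parity in Gale's condition. It is achieved by letting the heights
  decrease fast, so that the vertex with the smallest index decides the sign.
\<close>

lemma ex_lifting:
  "\<exists>f z. \<forall>l\<in>increasing_lists (Suc N) 0 (Suc CARD('n)). (\<forall>a\<in>set l. z l \<bullet> V a = f a) \<and>
     (\<forall>j\<le>N. j \<notin> set l \<longrightarrow> 0 < (-1) ^ length (filter (\<lambda>a. a < j) l) * (f j - z l \<bullet> V j))"
proof -
  have "\<exists>c. V j = (\<Sum>a\<in>set l. c a *\<^sub>R V a)" if "l \<in> increasing_lists (Suc N) 0 (Suc CARD('n))" for l j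
    using pos[OF that] that by (intro ldet_spanning) (auto simp: increasing_lists_def)
  then have "\<exists>c. \<forall>j. V j = (\<Sum>a\<in>set l. c j a *\<^sub>R V a)"
    if "l \<in> increasing_lists (Suc N) 0 (Suc CARD('n))" for l
    using that by (intro choice allI)
  then have "\<exists>c. \<forall>l\<in>increasing_lists (Suc N) 0 (Suc CARD('n)). \<forall>j. V j = (\<Sum>a\<in>set l. c l j a *\<^sub>R V a)"
    by (intro bchoice ballI)
  then obtain c where c: "\<And>l j. l \<in> increasing_lists (Suc N) 0 (Suc CARD('n)) \<Longrightarrow> V j = (\<Sum>a\<in>set l. c l j a *\<^sub>R V a)"
    by blast
  \<comment> \<open>By the expansion of \<open>V j\<close>, summing \<open>G l j i * f i\<close>
    gives \<open>f j - z l \<bullet> V j\<close> times the parity sign, for any heights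
    \<open>f\<close>. The required signs thus become finitely many linear inequalities in
    \<open>f\<close>.\<close>
  define G where "G l j i = (-1) ^ length (filter (\<lambda>a. a < j) l) *
    (if i = j then 1 else if i \<in> set l then - c l j i else 0)" for l j i
  define F where "F = (\<lambda>(l, j). G l j) ` {(l, j). l \<in> increasing_lists (Suc N) 0 (Suc CARD('n)) \<and> j \<le> N \<and> j \<notin> set l}"
  have "finite {(l, j). l \<in> increasing_lists (Suc N) 0 (Suc CARD('n)) \<and> j \<le> N \<and> j \<notin> set l}"
  proof (rule finite_subset)
    show "finite (increasing_lists (Suc N) 0 (Suc CARD('n)) \<times> {..N})"
      by (simp add: finite_increasing_lists)
  qed auto
  then have "finite F" unfolding F_def by (rule finite_imageI)
  moreover have "\<exists>i\<le>N. 0 < g i \<and> (\<forall>k<i. g k = 0)" if gF: "g \<in> F" for g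
  proof -
    obtain l j where l: "l \<in> increasing_lists (Suc N) 0 (Suc CARD('n))" and j: "j \<le> N" "j \<notin> set l" and g: "g = G l j"
      using gF by (auto simp: F_def)
    then have l': "sorted_wrt (<) l" "length l = Suc CARD('n)" "set l \<subseteq> {0..<Suc N}"
      by (simp_all add: increasing_lists_def)
    obtain a as where as: "l = a # as" "sorted_wrt (<) l" "length l = Suc CARD('n)" "set l \<subseteq> {0..<Suc N}"
      using l' by (cases l) auto
    \<comment> \<open>The first non-zero entry of \<open>G l j\<close> sits at the smaller of
      \<open>j\<close> and the first vertex \<open>a\<close>. If it is \<open>j\<close>, no vertex
      lies below \<open>j\<close> and the entry is \<open>1\<close>.\<close>
    show ?thesis
    proof (cases "j < a")
      case True
      then have "filter (\<lambda>a. a < j) l = []" and "k \<notin> set l" if "k < j" for k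
        using as that by (auto simp: filter_empty_conv)
      moreover have "filter (\<lambda>a. a < j) l = []" using as True by (auto simp: filter_empty_conv)
      ultimately show ?thesis using j True by (intro exI[of _ j]) (auto simp: g G_def)
    next
      case False
      \<comment> \<open>By Cramer's rule \<open>c l j a\<close> has the sign of the determinant with
        \<open>a\<close> replaced by \<open>j\<close>, which becomes sorted and positive after
        \<open>j\<close> moves past \<open>ys\<close>. The parity in \<open>G\<close> also counts
        \<open>a\<close>, and this extra sign cancels the minus in front of
        \<open>c l j a\<close>.\<close>
      define ys where "ys = filter (\<lambda>a. a < j) as"
      define zs where "zs = filter (\<lambda>a. \<not> a < j) as"
      have ysz: "as = ys @ zs" using sorted_wrt_filter_split[of as j] as by (simp add: ys_def zs_def)
      have zs: "\<forall>z\<in>set zs. j < z" using j as by (auto simp: zs_def not_less order.order_iff_strict)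
      have ys: "\<forall>y\<in>set ys. y < j" by (auto simp: ys_def)
      have "ys @ j # zs \<in> increasing_lists (Suc N) 0 (Suc CARD('n))"
        using as j ysz ys zs by (auto simp: increasing_lists_def sorted_wrt_append)
      from pos[OF this] have "0 < ldet (map V ys @ V j # map V zs)" by simp
      then have 1: "0 < (-1) ^ length ys * ldet (V j # map V as)"
        using ldet_move[of "[]" "map V ys" "map V zs" "V j"] as ysz by simp
      have "distinct l" using as(2) by (simp add: strict_sorted_iff)
      then have "ldet (V j # map V as) = c l j a * ldet (map V l)"
        using ldet_head_coefficient[of a as "V j" "c l j" V] c[OF l, of j] as by simp
      then have "0 < ((-1) ^ length ys * c l j a) * ldet (map V l)" using 1 by (simp add: mult.assoc)
      then have "0 < (-1) ^ length ys * c l j a" using pos[OF l] by (simp add: zero_less_mult_iff)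
      moreover have "length (filter (\<lambda>a. a < j) l) = Suc (length ys)"
        using False as j by (auto simp: ys_def)
      moreover have "k \<notin> set l" "k \<noteq> j" if "k < a" for k using that as False by auto
      ultimately show ?thesis using as False j by (intro exI[of _ a]) (auto simp: g G_def)
    qed
  qed
  ultimately obtain f where f: "\<And>g. g \<in> F \<Longrightarrow> 0 < (\<Sum>i\<le>N. g i * f i)"
    using lexicographically_positive_functional[of F N] by blast
  have "\<exists>z. \<forall>a\<in>set l. z \<bullet> V a = f a" if "l \<in> increasing_lists (Suc N) 0 (Suc CARD('n))" for l
    using pos[OF that] that by (intro ldet_dual) (auto simp: increasing_lists_def)
  then have "\<exists>z. \<forall>l\<in>increasing_lists (Suc N) 0 (Suc CARD('n)). \<forall>a\<in>set l. z l \<bullet> V a = f a"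
    by (intro bchoice) blast
  then obtain z where z: "\<And>l a. l \<in> increasing_lists (Suc N) 0 (Suc CARD('n)) \<Longrightarrow> a \<in> set l \<Longrightarrow> z l \<bullet> V a = f a"
    by blast
  have "0 < (-1) ^ length (filter (\<lambda>a. a < j) l) * (f j - z l \<bullet> V j)"
    if l: "l \<in> increasing_lists (Suc N) 0 (Suc CARD('n))" and j: "j \<le> N" "j \<notin> set l" for l j
  proof -
    let ?s = "(-1) ^ length (filter (\<lambda>a. a < j) l) :: real"
    have sub: "set l \<subseteq> {..N}" using l by (auto simp: increasing_lists_def)
    have "0 < (\<Sum>i\<le>N. G l j i * f i)" using l j by (intro f) (auto simp: F_def)
    also have "(\<Sum>i\<le>N. G l j i * f i) =
        (\<Sum>i\<le>N. ?s * ((if i = j then f j else 0) - (if i \<in> set l then c l j i * f i else 0)))"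
      using j by (intro sum.cong) (auto simp: G_def)
    also have "\<dots> = ?s * (f j - (\<Sum>i\<in>set l. c l j i * f i))"
      using j sub by (simp add: sum_subtractf sum.inter_restrict[symmetric] Int_absorb1 flip: sum_distrib_left)
    also have "(\<Sum>i\<in>set l. c l j i * f i) = z l \<bullet> V j"
      using c[OF l, of j] z[OF l] by (simp add: inner_sum_right)
    finally show ?thesis .
  qed
  then show ?thesis using z by (intro exI[of _ f] exI[of _ z]) simp
qed

lemma convex_hull_repr:
  assumes "p \<in> convex hull (v ` set l)"
  shows "\<exists>u. (\<forall>a\<in>set l. 0 \<le> u a) \<and> sum u (set l) = 1 \<and> p = (\<Sum>a\<in>set l. u a *\<^sub>R v a) \<and>
    (\<forall>z. z \<bullet> homog p = (\<Sum>a\<in>set l. u a * (z \<bullet> V a)))"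
proof -
  obtain u where u: "\<forall>a\<in>set l. 0 \<le> u a" "sum u (set l) = 1" "p = (\<Sum>a\<in>set l. u a *\<^sub>R v a)"
    using assms by (auto simp: convex_hull_image_iff)
  then have "homog p = (\<Sum>a\<in>set l. u a *\<^sub>R V a)"
    using homog_eq_sum_iff[where p = p and A = "set l" and c = u and v = v] by simp
  then show ?thesis using u by (intro exI[of _ u]) (simp add: inner_sum_right)
qed

text \<open>
  On a Gale simplex the linear functional \<open>z l\<close> is the minimal cost, with respect to the heights, of
  representing a point as a convex combination. By strictness all optimal representations of a
  common point of two Gale simplices use only common vertices.
\<close>

lemma gale_simplices_overlap:
  assumes l: "l \<in> gale_lists N 0 (Suc CARD('n))" and l': "l' \<in> gale_lists N 0 (Suc CARD('n))" and "l \<noteq> l'"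
  shows "negligible (convex hull (v ` set l) \<inter> convex hull (v ` set l'))"
proof -
  obtain f z where fz: "\<And>l a. l \<in> increasing_lists (Suc N) 0 (Suc CARD('n)) \<Longrightarrow> a \<in> set l \<Longrightarrow> z l \<bullet> V a = f a"
    "\<And>l j. l \<in> increasing_lists (Suc N) 0 (Suc CARD('n)) \<Longrightarrow> j \<le> N \<Longrightarrow> j \<notin> set l \<Longrightarrow> 0 < (-1) ^ length (filter (\<lambda>a. a < j) l) * (f j - z l \<bullet> V j)"
    using ex_lifting by metis
  have IL: "l \<in> increasing_lists (Suc N) 0 (Suc CARD('n))" "l' \<in> increasing_lists (Suc N) 0 (Suc CARD('n))" using l l' by (auto simp: gale_lists_def)
  have sub: "set l \<subseteq> {..N}" "set l' \<subseteq> {..N}" using IL by (auto simp: increasing_lists_def)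
  have strict: "z k \<bullet> V j < f j" if "k \<in> gale_lists N 0 (Suc CARD('n))" "j \<le> N" "j \<notin> set k" for k j
    using fz(2)[of k j] that by (auto simp: gale_lists_def)
  have weak: "z k \<bullet> V j \<le> f j" if "k \<in> gale_lists N 0 (Suc CARD('n))" "j \<le> N" for k j
    using fz(1)[of k j] strict[of k j] that by (cases "j \<in> set k") (auto simp: gale_lists_def)
  \<comment> \<open>\<open>z k'\<close> takes the values \<open>f\<close> at the vertices of
    \<open>k'\<close>, while \<open>z k\<close> lies weakly below \<open>f\<close> at all points
    because \<open>k\<close> is a Gale list.\<close>
  have le: "z k \<bullet> homog p \<le> z k' \<bullet> homog p"
    if k: "k \<in> gale_lists N 0 (Suc CARD('n))" "k' \<in> increasing_lists (Suc N) 0 (Suc CARD('n))" "p \<in> convex hull (v ` set k')" for k k' p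
  proof -
    obtain u where u: "\<And>a. a \<in> set k' \<Longrightarrow> 0 \<le> u a" "sum u (set k') = 1" "p = (\<Sum>a\<in>set k'. u a *\<^sub>R v a)"
      "\<And>z. z \<bullet> homog p = (\<Sum>a\<in>set k'. u a * (z \<bullet> V a))"
      using convex_hull_repr[OF k(3)] by blast
    show ?thesis unfolding u(4)
      using k weak[OF k(1)] fz(1)[OF k(2)] u(1)
      by (intro sum_mono mult_left_mono) (auto simp: increasing_lists_def)
  qed
  have "convex hull (v ` set l) \<inter> convex hull (v ` set l') \<subseteq> convex hull (v ` (set l \<inter> set l'))"
  proof
    fix p assume p: "p \<in> convex hull (v ` set l) \<inter> convex hull (v ` set l')"
    obtain u where u: "\<And>a. a \<in> set l' \<Longrightarrow> 0 \<le> u a" "sum u (set l') = 1" "p = (\<Sum>a\<in>set l'. u a *\<^sub>R v a)"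
      "\<And>z. z \<bullet> homog p = (\<Sum>a\<in>set l'. u a * (z \<bullet> V a))"
      using convex_hull_repr[of p l'] p by blast
    have "z l \<bullet> homog p = z l' \<bullet> homog p"
      using le[OF l IL(2), of p] le[OF l' IL(1), of p] p by simp
    then have "(\<Sum>a\<in>set l'. u a * (z l' \<bullet> V a - z l \<bullet> V a)) = 0"
      by (simp add: u(4) right_diff_distrib sum_subtractf)
    moreover have "0 \<le> u a * (z l' \<bullet> V a - z l \<bullet> V a)" if "a \<in> set l'" for a
      using weak[OF l, of a] fz(1)[OF IL(2) that] u(1)[OF that] sub that by auto
    ultimately have zero: "u a * (z l' \<bullet> V a - z l \<bullet> V a) = 0" if "a \<in> set l'" for a
      using that sum_nonneg_eq_0_iff[of "set l'" "\<lambda>a. u a * (z l' \<bullet> V a - z l \<bullet> V a)"] by simp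
    have u0: "u a = 0" if "a \<in> set l' - set l \<inter> set l'" for a
      using zero[of a] strict[OF l, of a] fz(1)[OF IL(2), of a] sub that by auto
    have "sum u (set l \<inter> set l') = 1"
      unfolding u(2)[symmetric] by (rule sum.mono_neutral_left) (use u0 in auto)
    moreover have "p = (\<Sum>a\<in>set l \<inter> set l'. u a *\<^sub>R v a)"
      unfolding u(3) by (rule sum.mono_neutral_right) (use u0 in auto)
    ultimately show "p \<in> convex hull (v ` (set l \<inter> set l'))"
      using u(1) by (subst convex_hull_image_iff) auto
  qed
  moreover have "negligible (convex hull (v ` (set l \<inter> set l')))"
  proof -
    have dist: "distinct l" "distinct l'" "length l = Suc CARD('n)" "length l' = Suc CARD('n)"
      and sorted: "sorted_wrt (<) l" "sorted_wrt (<) l'"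
      using IL by (auto simp: increasing_lists_def strict_sorted_iff)
    have "set l \<noteq> set l'"
      using \<open>l \<noteq> l'\<close> strict_sorted_equal[OF sorted] by auto
    then have "set l \<inter> set l' \<subset> set l"
      using dist card_subset_eq[of "set l'" "set l"] by (auto simp: distinct_card)
    then have "card (set l \<inter> set l') < Suc CARD('n)"
      using psubset_card_mono[of "set l"] dist by (simp add: distinct_card)
    then have "card (v ` (set l \<inter> set l')) \<le> DIM((real, 'n) vec)"
      using card_image_le[of "set l \<inter> set l'" v] by simp
    then show ?thesis
      by (simp add: negligible_convex_interior convex_convex_hull empty_interior_convex_hull)
  qed
  ultimately show ?thesis by (rule negligible_subset[rotated])
qed

text \<open>
  A simplex of minimal cost containing \<open>p\<close> satisfies Gale's condition, since otherwise one pivot step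
  as in the simplex method would decrease the cost.
\<close>

lemma gale_simplices_cover:
  assumes p: "p \<in> convex hull (v ` {..N})"
    and generic: "\<And>B. B \<subseteq> {..N} \<Longrightarrow> card B \<le> CARD('n) \<Longrightarrow> p \<notin> convex hull (v ` B)"
  shows "\<exists>l\<in>gale_lists N 0 (Suc CARD('n)). p \<in> convex hull (v ` set l)"
proof -
  obtain f z where fz: "\<And>l a. l \<in> increasing_lists (Suc N) 0 (Suc CARD('n)) \<Longrightarrow> a \<in> set l \<Longrightarrow> z l \<bullet> V a = f a"
    "\<And>l j. l \<in> increasing_lists (Suc N) 0 (Suc CARD('n)) \<Longrightarrow> j \<le> N \<Longrightarrow> j \<notin> set l \<Longrightarrow> 0 < (-1) ^ length (filter (\<lambda>a. a < j) l) * (f j - z l \<bullet> V j)"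
    using ex_lifting by blast
  have IL_of_set: "sorted_list_of_set B \<in> increasing_lists (Suc N) 0 (Suc CARD('n))" if "B \<subseteq> {..N}" "card B = Suc CARD('n)" for B
    using that finite_subset[OF that(1)] by (auto simp: increasing_lists_def)
  define K where "K = {l \<in> increasing_lists (Suc N) 0 (Suc CARD('n)). p \<in> convex hull (v ` set l)}"
  have "finite K" unfolding K_def using finite_increasing_lists by simp
  have "K \<noteq> {}"
  proof -
    \<comment> \<open>Caratheodory bounds the number of vertices by \<open>d + 1\<close>, and
      genericity of \<open>p\<close> excludes fewer.\<close>
    obtain S where S: "finite S" "S \<subseteq> v ` {..N}" "card S \<le> DIM((real, 'n) vec) + 1" "p \<in> convex hull S"
      using p unfolding caratheodory[of "v ` {..N}"] by blast
    obtain B where B: "B \<subseteq> {..N}" "inj_on v B" "S = v ` B"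
      using S(2) unfolding subset_image_inj by blast
    have "card B = card S" using B by (simp add: card_image)
    then have "card B \<le> Suc CARD('n)" using S(3) by simp
    moreover have "\<not> card B \<le> CARD('n)" using generic[OF B(1)] S(4) B(3) by blast
    ultimately have "card B = Suc CARD('n)" by simp
    then have "sorted_list_of_set B \<in> K"
      using IL_of_set[OF B(1)] S(4) B finite_subset[OF B(1)] by (auto simp: K_def)
    then show ?thesis by blast
  qed
  then obtain l where l: "l \<in> K" "\<And>k. k \<in> K \<Longrightarrow> z l \<bullet> homog p \<le> z k \<bullet> homog p"
    using arg_min_if_finite(1)[of K "\<lambda>l. z l \<bullet> homog p"] arg_min_least[of K _ "\<lambda>l. z l \<bullet> homog p"] \<open>finite K\<close>
    by blast
  have IL: "l \<in> increasing_lists (Suc N) 0 (Suc CARD('n))" and pl: "p \<in> convex hull (v ` set l)" using l(1) by (auto simp: K_def)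
  have sub: "set l \<subseteq> {..N}" using IL by (auto simp: increasing_lists_def)
  have card: "card (set l) = Suc CARD('n)"
    using IL by (auto simp: increasing_lists_def strict_sorted_iff distinct_card)
  obtain u where u: "\<And>a. a \<in> set l \<Longrightarrow> 0 \<le> u a" "sum u (set l) = 1" "p = (\<Sum>a\<in>set l. u a *\<^sub>R v a)"
    "\<And>z. z \<bullet> homog p = (\<Sum>a\<in>set l. u a * (z \<bullet> V a))"
    using convex_hull_repr[OF pl] by blast
  \<comment> \<open>Non-degeneracy in the sense of the simplex method; it makes the step length
    \<open>e\<close> of the pivot positive.\<close>
  have u_pos: "0 < u a" if a: "a \<in> set l" for a
  proof (rule ccontr)
    assume "\<not> 0 < u a"
    then have "u a = 0" using u(1)[OF a] by simp
    then have "sum u (set l - {a}) = 1" "p = (\<Sum>a\<in>set l - {a}. u a *\<^sub>R v a)"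
      using u(2,3) a by (simp_all add: sum.remove)
    then have "p \<in> convex hull (v ` (set l - {a}))"
      using u(1) by (subst convex_hull_image_iff) auto
    moreover have "card (set l - {a}) \<le> CARD('n)" using card a by simp
    ultimately show False using generic[of "set l - {a}"] sub by blast
  qed
  have "even (length (filter (\<lambda>a. a < j) l))" if j: "j \<in> {0..N} - set l" for j
  proof (rule ccontr)
    assume odd: "odd (length (filter (\<lambda>a. a < j) l))"
    then have less: "f j < z l \<bullet> V j" using fz(2)[OF IL, of j] j by simp
    obtain c where "V j = (\<Sum>a\<in>set l. c a *\<^sub>R V a)"
      using ldet_spanning[of l V "V j"] pos[OF IL] IL by (auto simp: increasing_lists_def)
    then have c: "sum c (set l) = 1" "v j = (\<Sum>a\<in>set l. c a *\<^sub>R v a)"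
      using homog_eq_sum_iff[where p = "v j" and A = "set l" and c = c and v = v] by auto
    have cV: "z' \<bullet> V j = (\<Sum>a\<in>set l. c a * (z' \<bullet> V a))" for z'
      using \<open>V j = _\<close> by (simp add: inner_sum_right)
    define P where "P = {a \<in> set l. 0 < c a}"
    have "finite P" by (simp add: P_def)
    have "P \<noteq> {}"
    proof
      assume "P = {}"
      then have "sum c (set l) \<le> 0" by (intro sum_nonpos) (auto simp: P_def not_less)
      then show False using c by simp
    qed
    \<comment> \<open>Ratio test: putting weight \<open>e\<close> on \<open>j\<close> takes
      \<open>e * c a\<close> from each vertex \<open>a\<close>. The minimal ratio belongs to the
      vertex whose weight is exhausted first, so \<open>b\<close> leaves and all other weights stay
      non-negative.\<close>
    then obtain b where b: "b \<in> P" "\<And>a. a \<in> P \<Longrightarrow> u b / c b \<le> u a / c a"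
      using arg_min_if_finite(1)[of P "\<lambda>a. u a / c a"] arg_min_least[of P _ "\<lambda>a. u a / c a"]
        \<open>finite P\<close> by blast
    define e where "e = u b / c b"
    have bl: "b \<in> set l" "0 < c b" using b by (auto simp: P_def)
    have "0 < e" using bl u_pos by (simp add: e_def)
    define w where "w a = (if a = j then e else u a - e * c a)" for a
    have wb: "u b - e * c b = 0" using bl by (simp add: e_def)
    have w_nonneg: "0 \<le> u a - e * c a" if a: "a \<in> set l" for a
    proof (cases "0 < c a")
      case True
      then have "e \<le> u a / c a" using b(2)[of a] a by (simp add: P_def e_def)
      then show ?thesis using True by (simp add: pos_le_divide_eq)
    next
      case False
      then have "e * c a \<le> 0" using \<open>0 < e\<close> by (simp add: mult_nonneg_nonpos)
      then show ?thesis using u(1)[OF a] by simp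
    qed
    define B where "B = insert j (set l - {b})"
    \<comment> \<open>Stated for arbitrary \<open>g\<close>, because it is applied to the constant
      \<open>1\<close>, to the points and to the heights.\<close>
    have sum_w: "(\<Sum>a\<in>B. w a *\<^sub>R g a) = e *\<^sub>R g j + (\<Sum>a\<in>set l. u a *\<^sub>R g a) - e *\<^sub>R (\<Sum>a\<in>set l. c a *\<^sub>R g a)"
      for g :: "nat \<Rightarrow> 'b::real_vector"
    proof -
      have "(\<Sum>a\<in>B. w a *\<^sub>R g a) = e *\<^sub>R g j + (\<Sum>a\<in>set l - {b}. w a *\<^sub>R g a)"
        unfolding B_def using j by (subst sum.insert) (auto simp: w_def)
      also have "(\<Sum>a\<in>set l - {b}. w a *\<^sub>R g a) = (\<Sum>a\<in>set l - {b}. (u a - e * c a) *\<^sub>R g a)"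
        using j by (intro sum.cong) (auto simp: w_def)
      also have "\<dots> = (\<Sum>a\<in>set l. (u a - e * c a) *\<^sub>R g a)"
        using bl by (simp add: sum.remove[of "set l" b] wb)
      also have "\<dots> = (\<Sum>a\<in>set l. u a *\<^sub>R g a) - e *\<^sub>R (\<Sum>a\<in>set l. c a *\<^sub>R g a)"
        by (simp add: scaleR_left_diff_distrib sum_subtractf scaleR_sum_right)
      finally show ?thesis by simp
    qed
    have wB: "sum w B = 1" "p = (\<Sum>a\<in>B. w a *\<^sub>R v a)"
      using sum_w[of "\<lambda>_. 1::real"] sum_w[of v] u(2,3) c by simp_all
    have w0: "\<forall>a\<in>B. 0 \<le> w a" using w_nonneg \<open>0 < e\<close> by (auto simp: B_def w_def)
    have B: "B \<subseteq> {..N}" "card B = Suc CARD('n)" "finite B"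
      using j sub card bl by (auto simp: B_def)
    define k where "k = sorted_list_of_set B"
    have k: "k \<in> increasing_lists (Suc N) 0 (Suc CARD('n))" "set k = B" using IL_of_set[OF B(1,2)] B by (auto simp: k_def)
    have "p \<in> convex hull (v ` B)"
      using wB w0 B by (subst convex_hull_image_iff) auto
    then have "k \<in> K" using k by (simp add: K_def)
    have "homog p = (\<Sum>a\<in>B. w a *\<^sub>R V a)" using homog_eq_sum_iff[where p = p and A = B and c = w and v = v] wB by simp
    then have "z k \<bullet> homog p = (\<Sum>a\<in>B. w a *\<^sub>R f a)"
      using fz(1)[OF k(1)] k(2) by (simp add: inner_sum_right)
    also have "\<dots> = e * f j + (\<Sum>a\<in>set l. u a * f a) - e * (\<Sum>a\<in>set l. c a * f a)"
      using sum_w[of f] by simp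
    also have "\<dots> = e * f j + z l \<bullet> homog p - e * (z l \<bullet> V j)"
      using fz(1)[OF IL] by (simp add: u(4) cV)
    \<comment> \<open>The pivot changes the cost by \<open>e * (f j - z l \<bullet> V j)\<close>,
      which is negative since \<open>j\<close> has an odd number of vertices below it.\<close>
    also have "\<dots> < z l \<bullet> homog p" using less \<open>0 < e\<close> by simp
    finally show False using l(2)[OF \<open>k \<in> K\<close>] by simp
  qed
  then have "l \<in> gale_lists N 0 (Suc CARD('n))" using IL by (simp add: gale_lists_def)
  then show ?thesis using pl by blast
qed

text \<open>The simplex formula based at the first vertex. Row reduction replaces differences from
  that vertex by consecutive ones, and \<open>pos\<close> makes the vertices distinct and removes
  the absolute value.\<close>

lemma measure_gale_simplex:
  assumes "l \<in> increasing_lists (Suc N) 0 (Suc CARD('n))"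
  shows "measure lebesgue (convex hull (v ` set l)) = ldet (cdiffs (map v l)) / fact CARD('n)"
proof -
  have len: "length l = Suc CARD('n)" using assms by (auto simp: increasing_lists_def)
  then obtain a as where as: "l = a # as" "length as = CARD('n)" by (auto simp: length_Suc_conv)
  have dV: "distinct (map V l)"
    using pos[OF assms] ldet_not_distinct[of "map V l"] len by auto
  then have "distinct (map v l)" by (auto simp: distinct_map inj_on_def)
  then have dist: "distinct l" "inj_on v (set l)" by (auto simp: distinct_map)
  have nth: "bij_betw (\<lambda>k::'n. as ! idx k) UNIV (set as)"
  proof -
    have "bij_betw ((!) as) {..<CARD('n)} (set as)" using dist as by (intro bij_betw_nth) auto
    from bij_betw_trans[OF bij_betw_idx this] show ?thesis by (simp add: o_def)
  qed
  moreover have "bij_betw v (set as) (v ` set l - {v a})"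
    using dist as by (auto simp: bij_betw_def inj_on_def)
  ultimately have "bij_betw (\<lambda>k::'n. v (as ! idx k)) UNIV (v ` set l - {v a})"
    using bij_betw_trans[of "\<lambda>k::'n. as ! idx k" UNIV "set as" v] by (simp add: o_def)
  then have "measure lebesgue (convex hull (v ` set l)) = \<bar>det (\<chi> i::'n. v (as ! idx i) - v a)\<bar> / fact CARD('n)"
    using dist as by (intro measure_simplex_linorder) (auto simp: card_image distinct_card)
  also have "(\<chi> i::'n. v (as ! idx i) - v a) = (\<chi> i. map (\<lambda>w. w - v a) (map v as) ! idx i)"
    using as idx_less[where 'm = 'n] by (auto simp: vec_eq_iff)
  also have "det \<dots> = ldet (map (\<lambda>w. w - v a) (map v as))" by (simp add: ldet_def)
  also have "\<dots> = ldet (cdiffs (map v l))" using ldet_cdiffs[of "map v as" "v a"] as by simp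
  finally have *: "measure lebesgue (convex hull (v ` set l)) = \<bar>ldet (cdiffs (map v l))\<bar> / fact CARD('n)" .
  have "ldet (cdiffs (map v l)) = ldet (map V l)"
    using ldet_cdiffs[of "map v as" "v a"] ldet_homog[of "map v as" "v a"] as by (simp add: o_def)
  then show ?thesis using pos[OF assms] * by simp
qed

lemma measure_convex_hull_strict:
  "measure lebesgue (convex hull (v ` {..N})) =
     increasing_sum N 0 CARD('n) (\<lambda>l. ldet (map (\<lambda>k. v (Suc k) - v k) l)) / fact CARD('n)"
proof -
  let ?T = "gale_lists N 0 (Suc CARD('n))"
  let ?U = "\<Union>l\<in>?T. convex hull (v ` set l)"
  \<comment> \<open>The non-generic points, which \<open>gale_simplices_cover\<close> leaves out:
    finitely many hulls of at most \<open>d\<close> points, each negligible.\<close>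
  let ?B = "\<Union>B\<in>{B. B \<subseteq> {..N} \<and> card B \<le> CARD('n)}. convex hull (v ` B)"
  have meas: "convex hull (v ` A) \<in> lmeasurable" if "finite A" for A
    using that by (intro lmeasurable_compact finite_imp_compact_convex_hull) auto
  have sub: "set l \<subseteq> {..N}" if "l \<in> ?T" for l
    using that by (auto simp: gale_lists_def increasing_lists_def)
  have "negligible (convex hull (v ` B))" if "B \<subseteq> {..N}" "card B \<le> CARD('n)" for B
  proof -
    have "finite B" using that finite_subset by blast
    then have "card (v ` B) \<le> DIM((real, 'n) vec)" using card_image_le[of B v] that by simp
    then show ?thesis using \<open>finite B\<close>
      by (simp add: negligible_convex_interior convex_convex_hull empty_interior_convex_hull)
  qed
  then have "negligible ?B" by (intro negligible_Union) auto
  moreover have "convex hull (v ` {..N}) - ?U \<subseteq> ?B" using gale_simplices_cover by blast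
  moreover have "?U \<subseteq> convex hull (v ` {..N})" using sub by (intro UN_least hull_mono image_mono)
  ultimately have "measure lebesgue (convex hull (v ` {..N})) = measure lebesgue ?U"
    by (intro measure_negligible_symdiff[symmetric] fmeasurable.finite_UN finite_gale_lists meas)
       (auto intro: negligible_subset)
  also have "\<dots> = (\<Sum>l\<in>?T. measure lebesgue (convex hull (v ` set l)))"
    by (intro measure_negligible_finite_Union_image finite_gale_lists meas)
       (auto simp: pairwise_def gale_simplices_overlap)
  also have "\<dots> = (\<Sum>l\<in>?T. ldet (cdiffs (map v l)) / fact CARD('n))"
    by (intro sum.cong refl measure_gale_simplex) (simp add: gale_lists_def)
  also have "\<dots> = gale_sum N 0 (Suc CARD('n)) (\<lambda>l. ldet (cdiffs (map v l))) / fact CARD('n)"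
    by (simp add: sum_gale_lists flip: sum_divide_distrib)
  finally show ?thesis by (simp only: increasing_sum_ldet_eq_gale_sum)
qed

end

section \<open>Continuity of the volume of convex sets\<close>

lemma convex_hull_image_near:
  fixes f :: "'i \<Rightarrow> 'a::euclidean_space" and g :: "'j \<Rightarrow> 'a"
  assumes "\<And>a. a \<in> A \<Longrightarrow> \<exists>b\<in>B. dist (f a) (g b) < e"
    and p: "p \<in> convex hull (f ` A)"
  shows "\<exists>q\<in>convex hull (g ` B). dist p q < e"
proof -
  let ?S = "\<Union>x\<in>convex hull (g ` B). \<Union>y\<in>ball 0 e. {x + y}"
  have "convex hull (f ` A) \<subseteq> ?S"
  proof (rule hull_minimal)
    show "convex ?S" by (intro convex_sums convex_convex_hull convex_ball)
    show "f ` A \<subseteq> ?S"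
    proof clarify
      fix a assume "a \<in> A"
      then obtain b where "b \<in> B" "dist (f a) (g b) < e" using assms(1) by blast
      then show "f a \<in> ?S"
        by (intro UN_I[of "g b" "convex hull (g ` B)"] UN_I[of "f a - g b" "ball 0 e"])
           (auto simp: hull_inc dist_norm norm_minus_commute)
    qed
  qed
  then obtain x y where "x \<in> convex hull (g ` B)" "y \<in> ball 0 e" "p = x + y" using p by blast
  then show ?thesis by (intro bexI[of _ x]) (auto simp: dist_norm)
qed

text \<open>Under Hausdorff convergence the indicator functions converge at every point off
  \<open>frontier K\<close>, which is negligible because \<open>K\<close> is convex. Dominated
  convergence does the rest.\<close>

lemma tendsto_measure_convex:
  fixes K :: "'a::euclidean_space set"
  assumes K: "compact K" "convex K" and Ks: "\<And>m. compact (Ks m)" "\<And>m. convex (Ks m)"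
    and near1: "\<And>e. 0 < e \<Longrightarrow> \<forall>\<^sub>F m in sequentially. \<forall>p\<in>Ks m. \<exists>q\<in>K. dist p q < e"
    and near2: "\<And>e. 0 < e \<Longrightarrow> \<forall>\<^sub>F m in sequentially. \<forall>p\<in>K. \<exists>q\<in>Ks m. dist p q < e"
  shows "(\<lambda>m. measure lebesgue (Ks m)) \<longlonglongrightarrow> measure lebesgue K"
proof -
  obtain B where B: "K \<subseteq> ball 0 B"
    using compact_imp_bounded[OF K(1)] bounded_subset_ballD by blast
  have sub: "\<forall>\<^sub>F m in sequentially. Ks m \<subseteq> ball 0 (B + 1)"
    using near1[OF zero_less_one]
  proof eventually_elim
    case (elim m)
    show ?case
    proof
      fix p assume "p \<in> Ks m"
      then obtain q where "q \<in> K" "dist p q < 1" using elim by blast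
      then show "p \<in> ball 0 (B + 1)" using B norm_triangle_ineq2[of p q] by (auto simp: dist_norm)
    qed
  qed
  have meas: "S \<in> sets lebesgue" if "compact S" for S :: "'a set"
    using that by (metis borel_compact sets_completionI_sets sets_lborel)
  \<comment> \<open>Only eventually is \<open>Ks m\<close> inside the ball; cutting it off gives a
    bound valid for every \<open>m\<close>.\<close>
  let ?I = "\<lambda>m p. indicator (Ks m) p * indicator (ball 0 (B + 1)) p :: real"
  have "(\<lambda>m. \<integral>p. ?I m p \<partial>lebesgue) \<longlonglongrightarrow> (\<integral>p. indicator K p \<partial>lebesgue)"
  proof (rule integral_dominated_convergence)
    show "indicator K \<in> borel_measurable lebesgue" using K meas by simp
    show "?I m \<in> borel_measurable lebesgue" for m
      using Ks meas by (intro borel_measurable_times borel_measurable_indicator) auto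
    show "integrable lebesgue (indicator (ball 0 (B + 1) :: 'a set) :: 'a \<Rightarrow> real)"
      using emeasure_bounded_finite[OF bounded_ball, of 0 "B + 1"]
      by (intro integrable_real_indicator) auto
    show "AE p in lebesgue. norm (?I m p) \<le> indicator (ball 0 (B + 1)) p" for m
      by (auto simp: indicator_def)
    show "AE p in lebesgue. (\<lambda>m. ?I m p) \<longlonglongrightarrow> indicator K p"
    proof (rule AE_I')
      show "frontier K \<in> null_sets lebesgue"
        using negligible_convex_frontier[OF K(2)] by (simp add: negligible_iff_null_sets)
      show "{p \<in> space lebesgue. \<not> (\<lambda>m. ?I m p) \<longlonglongrightarrow> indicator K p} \<subseteq> frontier K"
      proof
        fix p assume p: "p \<in> {p \<in> space lebesgue. \<not> (\<lambda>m. ?I m p) \<longlonglongrightarrow> indicator K p}"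
        show "p \<in> frontier K"
        proof (rule ccontr)
          assume nf: "p \<notin> frontier K"
          have "\<forall>\<^sub>F m in sequentially. ?I m p = indicator K p"
          proof (cases "p \<in> K")
            case False
            then obtain e where e: "e > 0" "\<forall>q\<in>K. e \<le> dist p q"
              using separate_point_closed[OF compact_imp_closed[OF K(1)]] by blast
            show ?thesis using near1[OF e(1)]
            proof eventually_elim
              case (elim m)
              then have "p \<notin> Ks m" using e(2) by force
              then show ?case using False by simp
            qed
          next
            case True
            then have "p \<in> interior K"
              using nf closure_subset[of K] by (auto simp: frontier_def)
            then obtain e where e: "e > 0" "cball p e \<subseteq> K" by (auto simp: mem_interior_cball)
            show ?thesis using near2[OF e(1)] sub
            proof eventually_elim
              case (elim m)
              have "p \<in> Ks m"
              proof (rule ccontr)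
                assume "p \<notin> Ks m"
                then have "\<exists>a b. a \<bullet> p < b \<and> (\<forall>q\<in>Ks m. b < a \<bullet> q)"
                  by (rule separating_hyperplane_closed_point[OF Ks(2) compact_imp_closed[OF Ks(1)]])
                then obtain a b where ab: "a \<bullet> p < b" "\<forall>q\<in>Ks m. b < a \<bullet> q" by blast
                show False
                proof (cases "a = 0")
                  case True
                  obtain q where "q \<in> Ks m" using elim(1) \<open>p \<in> K\<close> by blast
                  then show False using ab True by force
                next
                  case False
                  \<comment> \<open>The point of \<open>cball p e\<close> farthest from
                    \<open>Ks m\<close> in the direction of the separating hyperplane. A point
                    within distance less than \<open>e\<close> of \<open>r\<close> cannot get past
                    \<open>p\<close> in direction \<open>a\<close>, so it cannot reach the other
                    side.\<close>
                  define r where "r = p - (e / norm a) *\<^sub>R a"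
                  have "r \<in> K" using e False by (intro subsetD[OF e(2)]) (simp add: r_def dist_norm)
                  then obtain q where q: "q \<in> Ks m" "dist r q < e" using elim(1) by blast
                  have "a \<bullet> r = a \<bullet> p - e * norm a"
                    using False by (simp add: r_def inner_diff_right dot_square_norm power2_eq_square)
                  moreover have "a \<bullet> (q - r) \<le> norm a * norm (q - r)" by (rule norm_cauchy_schwarz)
                  moreover have "norm a * norm (q - r) \<le> norm a * e"
                    using q(2) by (intro mult_left_mono) (simp_all add: dist_norm norm_minus_commute)
                  ultimately have "a \<bullet> q \<le> a \<bullet> p" by (simp add: inner_diff_right mult.commute)
                  then show False using ab q(1) by force
                qed
              qed
              then show ?case using True elim(2) by auto
            qed
          qed
          then have "(\<lambda>m. ?I m p) \<longlonglongrightarrow> indicator K p" by (rule tendsto_eventually)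
          then show False using p by simp
        qed
      qed
    qed
  qed
  also have "(\<integral>p. indicator K p \<partial>lebesgue) = measure lebesgue K"
    by (simp add: integral_indicator)
  finally show ?thesis
  proof (rule Lim_transform_eventually)
    show "\<forall>\<^sub>F m in sequentially. (\<integral>p. ?I m p \<partial>lebesgue) = measure lebesgue (Ks m)"
      using sub
    proof eventually_elim
      case (elim m)
      have "?I m = indicator (Ks m)" using elim by (auto simp: fun_eq_iff indicator_def)
      then show ?case by (simp add: integral_indicator)
    qed
  qed
qed

section \<open>Almost everywhere differentiability of Lipschitz functions\<close>

text \<open>An interval is a ball about its own midpoint, and the Vitali theorem for balls asks only
  that \<open>t\<close> lie in the ball, not that it be the centre.\<close>

lemma Vitali_covering_intervals:
  fixes S O' :: "real set"
  assumes "open O'" "S \<subseteq> O'"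
    and ex: "\<And>t \<delta>. t \<in> S \<Longrightarrow> 0 < \<delta> \<Longrightarrow> \<exists>u v. u < t \<and> t < v \<and> v - u < \<delta> \<and> P u v"
  obtains C where "countable C" "\<And>u v. (u, v) \<in> C \<Longrightarrow> u < v \<and> P u v \<and> {u<..<v} \<subseteq> O'"
    "disjoint_family_on (\<lambda>(u, v). {u<..<v}) C"
    "negligible (S - (\<Union>(u, v)\<in>C. {u<..<v}))"
proof -
  define a where "a = (\<lambda>(u::real, v). (u + v) / 2)"
  define r where "r = (\<lambda>(u::real, v). (v - u) / 2)"
  have ball: "ball (a c) (r c) = (case c of (u, v) \<Rightarrow> {u<..<v})" for c
    by (cases c) (auto simp: a_def r_def dist_real_def abs_less_iff field_simps)
  define K where "K = {(u, v). u < v \<and> P u v \<and> {u<..<v} \<subseteq> O'}"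
  have "\<exists>i. i \<in> K \<and> t \<in> ball (a i) (r i) \<and> r i < d" if td: "t \<in> S" "0 < d" for t d
  proof -
    obtain e where e: "e > 0" "ball t e \<subseteq> O'"
      using assms(1,2) td openE by blast
    obtain u v where uv: "u < t" "t < v" "v - u < min d e" "P u v"
      using ex[of t "min d e"] td e by auto
    have "{u<..<v} \<subseteq> ball t e"
      using uv by (auto simp: dist_real_def)
    then have "(u, v) \<in> K"
      using uv e by (auto simp: K_def)
    moreover have "r (u, v) < d"
      using uv by (simp add: r_def)
    ultimately show ?thesis
      using uv by (intro exI[of _ "(u, v)"]) (auto simp: ball)
  qed
  then obtain C where C: "countable C" "C \<subseteq> K"
    "pairwise (\<lambda>i j. disjnt (ball (a i) (r i)) (ball (a j) (r j))) C"
    "negligible (S - (\<Union>i\<in>C. ball (a i) (r i)))"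
    by (rule Vitali_covering_theorem_balls)
  have "disjoint_family_on (\<lambda>c. ball (a c) (r c)) C"
    using C(3) by (auto simp: disjoint_family_on_def pairwise_def disjnt_def)
  then show thesis
    using C by (intro that[of C]) (auto simp: ball K_def)
qed

text \<open>Points where the upper derivative, taken over short intervals around \<open>t\<close>,
  is at least \<open>q\<close>; \<open>flat\<close> concerns the lower derivative and
  \<open>p\<close>. Intervals with \<open>t\<close> inside, instead of at an end, suit the Vitali
  covering and make both sets visibly Borel.\<close>

definition steep :: "(real \<Rightarrow> real) \<Rightarrow> real \<Rightarrow> real set" where
  "steep F q = {t. \<forall>\<delta>>0. \<exists>u v. u < t \<and> t < v \<and> v - u < \<delta> \<and> q * (v - u) < F v - F u}"

definition flat :: "(real \<Rightarrow> real) \<Rightarrow> real \<Rightarrow> real set" where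
  "flat F p = {t. \<forall>\<delta>>0. \<exists>u v. u < t \<and> t < v \<and> v - u < \<delta> \<and> F v - F u < p * (v - u)}"

text \<open>A G-delta set: for fixed \<open>\<delta>\<close> the condition describes a union of open
  intervals, and the values \<open>1 / (n + 1)\<close> of \<open>\<delta>\<close> suffice.\<close>

lemma straddle_set_borel:
  "{t::real. \<forall>\<delta>>0. \<exists>u v. u < t \<and> t < v \<and> v - u < \<delta> \<and> P u v} \<in> sets borel" (is "?S \<in> _")
proof -
  define U where "U n = (\<Union>(u, v)\<in>{(u, v). v - u < inverse (real (Suc n)) \<and> P u v}. {u<..<v})"
    for n
  have "t \<in> ?S \<longleftrightarrow> (\<forall>n. t \<in> U n)" for t
  proof
    assume "t \<in> ?S"
    then have *: "\<exists>u v. u < t \<and> t < v \<and> v - u < \<delta> \<and> P u v" if "\<delta> > 0" for \<delta>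
      using that by simp
    show "\<forall>n. t \<in> U n"
    proof
      fix n
      obtain u v where "u < t" "t < v" "v - u < inverse (real (Suc n))" "P u v"
        using *[of "inverse (real (Suc n))"] by auto
      then show "t \<in> U n"
        unfolding U_def by (intro UN_I[of "(u, v)"]) auto
    qed
  next
    assume *: "\<forall>n. t \<in> U n"
    show "t \<in> ?S"
    proof (clarify)
      fix \<delta> :: real assume "\<delta> > 0"
      then obtain n where n: "inverse (real (Suc n)) < \<delta>" using reals_Archimedean by blast
      obtain u v where "v - u < inverse (real (Suc n))" "P u v" "u < t" "t < v"
        using *[rule_format, of n] unfolding U_def by (auto simp del: of_nat_Suc)
      then show "\<exists>u v. u < t \<and> t < v \<and> v - u < \<delta> \<and> P u v"
        using n by (intro exI[of _ u] exI[of _ v]) simp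
    qed
  qed
  then have "?S = (\<Inter>n. U n)" by (intro set_eqI) (simp only: INT_iff ball_UNIV)
  moreover have "open (U n)" for n unfolding U_def by auto
  ultimately show ?thesis by auto
qed

section \<open>Differentiability of monotone Lipschitz functions\<close>

context
  fixes F :: "real \<Rightarrow> real" and L :: real
  assumes F_mono: "mono F" and F_lip: "L-lipschitz_on UNIV F"
begin

lemma F_cont: "continuous_on UNIV F"
  using F_lip by (rule lipschitz_on_continuous_on)

text \<open>By continuity of \<open>F\<close> the endpoint \<open>v\<close> is not an atom.\<close>

lemma interval_measure_Ioo: "u < v \<Longrightarrow> emeasure (interval_measure F) {u<..<v} = ennreal (F v - F u)"
proof -
  assume "u < v"
  have m: "\<And>x y. x \<le> y \<Longrightarrow> F x \<le> F y" using F_mono by (rule monoD)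
  have c: "continuous (at_right a) F" for a
    using F_cont by (simp add: continuous_on_eq_continuous_at continuous_at_imp_continuous_at_within)
  have "emeasure (interval_measure F) {v..v} = 0"
    using emeasure_interval_measure_Icc[of v v F] m F_cont by simp
  then have "emeasure (interval_measure F) ({u<..v} - {v}) = emeasure (interval_measure F) {u<..v}"
    by (intro emeasure_Diff_null_set) (auto simp: null_sets_def)
  moreover have "{u<..v} - {v} = {u<..<v}" by auto
  ultimately show ?thesis
    using emeasure_interval_measure_Ioc[of u v F] m c \<open>u < v\<close> by simp
qed

text \<open>
  Compare Lebesgue measure with the Stieltjes measure of \<open>F\<close>: a Vitali covering by flat intervals
  bounds the latter by \<open>p\<close> times the former, and a finer covering by steep intervals gives the
  opposite bound with \<open>q\<close>.
\<close>

lemma negligible_steep_flat: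
  assumes "0 \<le> p" "p < q" "E \<subseteq> steep F q \<inter> flat F p" "E \<in> sets borel" "bounded E"
  shows "negligible E"
proof -
  let ?\<mu> = "interval_measure F"
  have fin: "emeasure lborel E < \<infinity>"
    using emeasure_bounded_finite[OF assms(5)] by simp
  define m where "m = measure lborel E"
  have m: "emeasure lborel E = ennreal m"
    using fin by (simp add: m_def emeasure_eq_ennreal_measure)
  have "q * m \<le> p * m + p * e" if e: "e > 0" for e
  proof -
    \<comment> \<open>The flat intervals are kept inside \<open>U\<close>, so their total length is
      at most \<open>m + e\<close>.\<close>
    obtain U where U: "open U" "E \<subseteq> U" "(U - E) \<in> lmeasurable" "emeasure lebesgue (U - E) < ennreal e"
      using sets_lebesgue_outer_open[of E e] sets_completionI_sets[of E lborel] assms(4) e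
      unfolding sets_lborel by blast
    obtain C where C: "countable C"
      "\<And>u v. (u, v) \<in> C \<Longrightarrow> u < v \<and> F v - F u < p * (v - u) \<and> {u<..<v} \<subseteq> U"
      "disjoint_family_on (\<lambda>(u, v). {u<..<v}) C"
      "negligible (E - (\<Union>(u, v)\<in>C. {u<..<v}))"
      by (rule Vitali_covering_intervals[OF U(1,2), of "\<lambda>u v. F v - F u < p * (v - u)"])
         (use assms(3) in \<open>auto simp: flat_def\<close>)
    define W where "W = (\<Union>(u, v)\<in>C. {u<..<v})"
    have "open W" unfolding W_def by auto
    have "emeasure ?\<mu> W = (\<integral>\<^sup>+c. emeasure ?\<mu> (case c of (u, v) \<Rightarrow> {u<..<v}) \<partial>count_space C)"
      unfolding W_def using C by (intro emeasure_UN_countable) auto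
    also have "\<dots> \<le> (\<integral>\<^sup>+c. ennreal p * emeasure lborel (case c of (u, v) \<Rightarrow> {u<..<v}) \<partial>count_space C)"
    proof (rule nn_integral_mono)
      fix c assume "c \<in> space (count_space C)"
      then obtain u v where "c = (u, v)" "u < v" "F v - F u < p * (v - u)"
        using C(2) by (cases c) auto
      then show "emeasure ?\<mu> (case c of (u, v) \<Rightarrow> {u<..<v})
          \<le> ennreal p * emeasure lborel (case c of (u, v) \<Rightarrow> {u<..<v})"
        using assms(1) by (simp add: interval_measure_Ioo ennreal_mult[symmetric] ennreal_leI)
    qed
    also have "\<dots> = ennreal p * (\<integral>\<^sup>+c. emeasure lborel (case c of (u, v) \<Rightarrow> {u<..<v}) \<partial>count_space C)"
      by (rule nn_integral_cmult) auto
    also have "(\<integral>\<^sup>+c. emeasure lborel (case c of (u, v) \<Rightarrow> {u<..<v}) \<partial>count_space C) = emeasure lborel W"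
      unfolding W_def using C by (intro emeasure_UN_countable[symmetric]) auto
    finally have 1: "emeasure ?\<mu> W \<le> ennreal p * emeasure lborel W" .
    have "emeasure lborel W \<le> emeasure lborel U"
      using C U \<open>open W\<close> by (intro emeasure_mono) (auto simp: W_def)
    also have "\<dots> \<le> emeasure lborel E + emeasure lborel (U - E)"
      using U assms by (subst plus_emeasure) (auto simp: Un_absorb1)
    also have "\<dots> \<le> ennreal (m + e)"
      using U assms that by (subst ennreal_plus) (auto simp: m m_def intro!: add_mono less_imp_le)
    finally have 2: "emeasure lborel W \<le> ennreal (m + e)" .
    \<comment> \<open>Choosing the steep intervals inside \<open>W\<close> bounds their Stieltjes
      measure by that of the flat ones.\<close>
    obtain D where D: "countable D"
      "\<And>u v. (u, v) \<in> D \<Longrightarrow> u < v \<and> q * (v - u) < F v - F u \<and> {u<..<v} \<subseteq> W"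
      "disjoint_family_on (\<lambda>(u, v). {u<..<v}) D"
      "negligible (E \<inter> W - (\<Union>(u, v)\<in>D. {u<..<v}))"
      by (rule Vitali_covering_intervals[OF \<open>open W\<close>, of "E \<inter> W" "\<lambda>u v. q * (v - u) < F v - F u"])
         (use assms(3) in \<open>auto simp: steep_def\<close>)
    define X where "X = (\<Union>(u, v)\<in>D. {u<..<v})"
    have "open X" unfolding X_def by auto
    have "negligible (E - X)"
      by (rule negligible_subset[OF negligible_Un[OF C(4) D(4)]]) (auto simp: W_def X_def)
    then have "emeasure lborel (E - X) = 0"
      using assms(4) \<open>open X\<close> by (simp add: negligible_iff_emeasure0 emeasure_completion)
    moreover have "emeasure lborel E \<le> emeasure lborel (E - X \<union> X)"
      using assms(4) \<open>open X\<close> by (intro emeasure_mono) auto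
    moreover have "emeasure lborel (E - X \<union> X) \<le> emeasure lborel (E - X) + emeasure lborel X"
      using assms(4) \<open>open X\<close> by (intro emeasure_subadditive) auto
    ultimately have "emeasure lborel E \<le> emeasure lborel X" by simp
    then have "ennreal q * emeasure lborel E \<le> ennreal q * emeasure lborel X"
      by (rule mult_left_mono) simp
    also have "emeasure lborel X = (\<integral>\<^sup>+c. emeasure lborel (case c of (u, v) \<Rightarrow> {u<..<v}) \<partial>count_space D)"
      unfolding X_def using D by (intro emeasure_UN_countable) auto
    also have "ennreal q * \<dots> = (\<integral>\<^sup>+c. ennreal q * emeasure lborel (case c of (u, v) \<Rightarrow> {u<..<v}) \<partial>count_space D)"
      by (rule nn_integral_cmult[symmetric]) auto
    also have "\<dots> \<le> (\<integral>\<^sup>+c. emeasure ?\<mu> (case c of (u, v) \<Rightarrow> {u<..<v}) \<partial>count_space D)"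
    proof (rule nn_integral_mono)
      fix c assume "c \<in> space (count_space D)"
      then obtain u v where "c = (u, v)" "u < v" "q * (v - u) < F v - F u"
        using D(2) by (cases c) auto
      then show "ennreal q * emeasure lborel (case c of (u, v) \<Rightarrow> {u<..<v})
          \<le> emeasure ?\<mu> (case c of (u, v) \<Rightarrow> {u<..<v})"
        using assms(1,2) by (simp add: interval_measure_Ioo ennreal_mult[symmetric] ennreal_leI)
    qed
    also have "\<dots> = emeasure ?\<mu> X"
      unfolding X_def using D by (intro emeasure_UN_countable[symmetric]) auto
    also have "\<dots> \<le> emeasure ?\<mu> W"
      using D(2) \<open>open W\<close> by (intro emeasure_mono) (auto simp: X_def)
    also note 1
    also have "ennreal p * emeasure lborel W \<le> ennreal p * ennreal (m + e)"
      using 2 by (rule mult_left_mono) simp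
    finally show ?thesis
      using assms(1,2) that unfolding m
      by (simp add: ennreal_mult[symmetric] m_def ennreal_le_iff algebra_simps flip: ennreal_plus)
  qed
  note * = this
  have "q * m \<le> p * m"
  proof (rule field_le_epsilon)
    fix e :: real assume "e > 0"
    \<comment> \<open>The denominator is \<open>p + 1\<close> because \<open>p\<close> may be
      \<open>0\<close>.\<close>
    then have "q * m \<le> p * m + p * (e / (p + 1))" using assms by (intro *) auto
    also have "p * (e / (p + 1)) \<le> e" using assms \<open>e > 0\<close> by (simp add: field_simps)
    finally show "q * m \<le> p * m + e" by simp
  qed
  then have "m \<le> 0" using assms by (simp add: mult_le_cancel_right)
  then have "m = 0" by (simp add: m_def measure_le_0_iff)
  then show ?thesis
    using m assms(4) by (simp add: negligible_iff_emeasure0 emeasure_completion)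
qed

lemma slope_bounds: "u \<le> v \<Longrightarrow> 0 \<le> F v - F u \<and> F v - F u \<le> L * (v - u)"
  using monoD[OF F_mono, of u v] lipschitz_onD[OF F_lip, of u v] by (auto simp: dist_real_def)

text \<open>The candidate derivative \<open>l\<close> is the upper derivative at \<open>t\<close>.
  If slopes below \<open>l - e\<close> occurred arbitrarily close to \<open>t\<close>, rationals
  \<open>p < q\<close> between \<open>l - e\<close> and \<open>l\<close> would put \<open>t\<close>
  into both \<open>flat F p\<close> and \<open>steep F q\<close>.\<close>

lemma differentiable_of_not_steep_flat:
  assumes "\<And>p q. p \<in> \<rat> \<Longrightarrow> q \<in> \<rat> \<Longrightarrow> 0 \<le> p \<Longrightarrow> p < q \<Longrightarrow> t \<notin> steep F q \<inter> flat F p"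
  shows "F differentiable (at t)"
proof -
  define Q where "Q = {q. t \<in> steep F q}"
  define l where "l = Sup Q"
  have up: "q \<le> L" if "q \<in> Q" for q
  proof -
    obtain u v where uv: "u < t" "t < v" "q * (v - u) < F v - F u"
      using \<open>q \<in> Q\<close> zero_less_one unfolding Q_def steep_def by blast
    then have "q * (v - u) < L * (v - u)" using slope_bounds[of u v] by linarith
    then show ?thesis using uv by (simp add: mult_less_cancel_right)
  qed
  have bdd: "bdd_above Q" using up by (rule bdd_aboveI)
  \<comment> \<open>By monotonicity every slope is non-negative. Hence \<open>Q\<close> is non-empty
    and \<open>l\<close> is at least \<open>0\<close>, and only rationals \<open>p \<ge> 0\<close>
    have to be excluded.\<close>
  have neg: "q \<in> Q" if "q < 0" for q
  proof -
    have "\<exists>u v. u < t \<and> t < v \<and> v - u < \<delta> \<and> q * (v - u) < F v - F u" if "\<delta> > 0" for \<delta>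
    proof -
      have "q * (\<delta>/2) < 0" using \<open>q < 0\<close> \<open>\<delta> > 0\<close> by (simp add: mult_neg_pos)
      then show ?thesis
        using slope_bounds[of "t - \<delta>/4" "t + \<delta>/4"] that
        by (intro exI[of _ "t - \<delta>/4"] exI[of _ "t + \<delta>/4"]) auto
    qed
    then show ?thesis by (simp add: Q_def steep_def)
  qed
  have "Q \<noteq> {}" using neg[of "-1"] by auto
  have "l \<ge> 0"
  proof (rule field_le_epsilon)
    fix e :: real assume "e > 0"
    then show "0 \<le> l + e" using cSup_upper[OF neg[of "-e"] bdd] by (simp add: l_def)
  qed
  have upper: "\<exists>\<delta>>0. \<forall>u v. u < t \<and> t < v \<and> v - u < \<delta> \<longrightarrow> F v - F u \<le> (l + e) * (v - u)" if "e > 0" for e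
  proof -
    have "l + e \<notin> Q" using cSup_upper[OF _ bdd, of "l + e"] that by (auto simp: l_def)
    then have "\<not> (\<forall>\<delta>>0. \<exists>u v. u < t \<and> t < v \<and> v - u < \<delta> \<and> (l + e) * (v - u) < F v - F u)"
      by (simp add: Q_def steep_def)
    then show ?thesis by (metis linorder_not_le)
  qed
  have lower: "\<exists>\<delta>>0. \<forall>u v. u < t \<and> t < v \<and> v - u < \<delta> \<longrightarrow> (l - e) * (v - u) \<le> F v - F u" if e: "e > 0" for e
  proof (cases "l - e \<le> 0")
    case True
    then have "(l - e) * (v - u) \<le> F v - F u" if "u < t" "t < v" for u v
      using that slope_bounds[of u v] mult_nonpos_nonneg[of "l - e" "v - u"] by linarith
    then show ?thesis using zero_less_one by blast
  next
    case False
    obtain p where p: "p \<in> \<rat>" "l - e < p" "p < l" using Rats_dense_in_real[of "l - e" l] e by auto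
    obtain q where q: "q \<in> \<rat>" "p < q" "q < l" using Rats_dense_in_real[of p l] p by auto
    obtain q' where q': "q' \<in> Q" "q < q'"
      using q less_cSup_iff[OF \<open>Q \<noteq> {}\<close> bdd, of q] by (auto simp: l_def)
    have "t \<in> steep F q" unfolding steep_def
    proof clarify
      fix \<delta> :: real assume "\<delta> > 0"
      then obtain u v where uv: "u < t" "t < v" "v - u < \<delta>" "q' * (v - u) < F v - F u"
        using q'(1) unfolding Q_def steep_def by blast
      moreover have "q * (v - u) \<le> q' * (v - u)" using q' uv by (intro mult_right_mono) auto
      ultimately show "\<exists>u v. u < t \<and> t < v \<and> v - u < \<delta> \<and> q * (v - u) < F v - F u"
        by (intro exI[of _ u] exI[of _ v] conjI) linarith+
    qed
    then have "t \<notin> flat F p" using assms[of p q] p q False by auto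
    then have "\<exists>\<delta>>0. \<forall>u v. u < t \<and> t < v \<and> v - u < \<delta> \<longrightarrow> p * (v - u) \<le> F v - F u"
      unfolding flat_def mem_Collect_eq by (metis linorder_not_le)
    then obtain \<delta> where \<delta>: "\<delta> > 0" "\<And>u v. u < t \<Longrightarrow> t < v \<Longrightarrow> v - u < \<delta> \<Longrightarrow> p * (v - u) \<le> F v - F u"
      by blast
    moreover have "(l - e) * (v - u) \<le> p * (v - u)" if "u < t" "t < v" for u v
      using that p by (intro mult_right_mono) auto
    ultimately show ?thesis by (intro exI[of _ \<delta>]) (meson order_trans)
  qed
  \<comment> \<open>Difference quotients at \<open>t\<close> use intervals ending at
    \<open>t\<close>, whereas the slope bounds concern intervals with \<open>t\<close> strictly
    inside. Widening by \<open>h\<close> on both sides and letting \<open>h\<close> tend to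
    \<open>0\<close> bridges the gap by continuity.\<close>
  have closed: "\<bar>F v - F u - l * (v - u)\<bar> \<le> e * (v - u)"
    if \<delta>: "\<And>u v. u < t \<Longrightarrow> t < v \<Longrightarrow> v - u < \<delta> \<Longrightarrow> \<bar>F v - F u - l * (v - u)\<bar> \<le> e * (v - u)"
      and uv: "u \<le> t" "t \<le> v" "v - u < \<delta>" for u v \<delta> e
  proof (rule tendsto_le)
    define \<eta> where "\<eta> = (\<delta> - (v - u)) / 2"
    have "\<eta> > 0" using uv by (simp add: \<eta>_def)
    then have "\<forall>\<^sub>F h in at_right 0. h < \<eta> \<and> h > 0"
      by (auto simp: eventually_at_right_field intro!: exI[of _ \<eta>])
    then show "\<forall>\<^sub>F h in at_right 0.
       \<bar>F (v + h) - F (u - h) - l * ((v + h) - (u - h))\<bar> \<le> e * ((v + h) - (u - h))"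
      by eventually_elim (rule \<delta>, use uv in \<open>auto simp: \<eta>_def field_simps\<close>)
    have "((\<lambda>h. F (v + h)) \<longlongrightarrow> F (v + 0)) (at_right 0)" "((\<lambda>h. F (u - h)) \<longlongrightarrow> F (u - 0)) (at_right 0)"
      by (rule isCont_tendsto_compose[where g = F];
          use F_cont in \<open>auto simp: continuous_on_eq_continuous_at intro!: tendsto_eq_intros\<close>)+
    then show "((\<lambda>h. \<bar>F (v + h) - F (u - h) - l * ((v + h) - (u - h))\<bar>) \<longlongrightarrow> \<bar>F v - F u - l * (v - u)\<bar>) (at_right 0)"
      by (auto intro!: tendsto_eq_intros)
    show "((\<lambda>h. e * ((v + h) - (u - h))) \<longlongrightarrow> e * (v - u)) (at_right 0)"
      by (auto intro!: tendsto_eq_intros)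
  qed simp
  have "(F has_derivative (\<lambda>h. l * h)) (at t)"
    unfolding has_derivative_at_alt
  proof (intro conjI allI impI)
    show "bounded_linear ((*) l)" by (rule bounded_linear_mult_right)
    fix e :: real assume "e > 0"
    obtain \<delta>1 where \<delta>1: "\<delta>1 > 0" "\<And>u v. u < t \<and> t < v \<and> v - u < \<delta>1 \<Longrightarrow> F v - F u \<le> (l + e) * (v - u)"
      using upper[OF \<open>e > 0\<close>] by blast
    obtain \<delta>2 where \<delta>2: "\<delta>2 > 0" "\<And>u v. u < t \<and> t < v \<and> v - u < \<delta>2 \<Longrightarrow> (l - e) * (v - u) \<le> F v - F u"
      using lower[OF \<open>e > 0\<close>] by blast
    define \<delta> where "\<delta> = min \<delta>1 \<delta>2"
    have sl: "\<bar>F v - F u - l * (v - u)\<bar> \<le> e * (v - u)" if "u < t" "t < v" "v - u < \<delta>" for u v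
      using \<delta>1(2)[of u v] \<delta>2(2)[of u v] that by (auto simp: \<delta>_def abs_le_iff algebra_simps)
    have cl: "\<bar>F v - F u - l * (v - u)\<bar> \<le> e * (v - u)" if "u \<le> t" "t \<le> v" "v - u < \<delta>" for u v
      using closed[of \<delta> e u v] sl that by blast
    show "\<exists>d>0. \<forall>y. norm (y - t) < d \<longrightarrow> norm (F y - F t - l * (y - t)) \<le> e * norm (y - t)"
    proof (intro exI[of _ \<delta>] conjI allI impI)
      show "\<delta> > 0" using \<delta>1 \<delta>2 by (simp add: \<delta>_def)
      fix y assume y: "norm (y - t) < \<delta>"
      show "norm (F y - F t - l * (y - t)) \<le> e * norm (y - t)"
      proof (cases "y \<ge> t")
        case True
        then show ?thesis using cl[of t y] y by simp
      next
        case False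
        then show ?thesis using cl[of y t] y by (auto simp: abs_le_iff algebra_simps)
      qed
    qed
  qed
  then show ?thesis by (auto simp: differentiable_def)
qed

text \<open>Rational slopes make the exceptional set a countable union, and the balls supply the
  boundedness that \<open>negligible_steep_flat\<close> asks for.\<close>

lemma negligible_not_differentiable_mono: "negligible {t. \<not> F differentiable (at t)}"
proof (rule negligible_subset)
  let ?I = "{(p, q, n::nat). p \<in> \<rat> \<and> q \<in> \<rat> \<and> 0 \<le> p \<and> p < q}"
  let ?E = "\<lambda>(p, q, n::nat). steep F q \<inter> flat F p \<inter> ball 0 (real n)"
  have "?I \<subseteq> \<rat> \<times> \<rat> \<times> UNIV" by auto
  then have "countable ?I"
    by (rule countable_subset) (auto intro!: countable_SIGMA countable_rat)
  moreover have "negligible (?E i)" if i: "i \<in> ?I" for i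
  proof -
    obtain p q n where "i = (p, q, n)" "0 \<le> p" "p < q" using i by auto
    moreover have "steep F q \<in> sets borel" "flat F p \<in> sets borel"
      unfolding steep_def flat_def by (rule straddle_set_borel)+
    moreover have "bounded (?E i)"
      using \<open>i = (p, q, n)\<close> by (simp add: bounded_Int)
    ultimately show ?thesis by (intro negligible_steep_flat[of p q]) auto
  qed
  ultimately show "negligible (\<Union>(?E ` ?I))"
    by (intro negligible_countable_Union countable_image) (assumption, erule imageE, simp only:)
  show "{t. \<not> F differentiable (at t)} \<subseteq> \<Union>(?E ` ?I)"
  proof
    fix t assume "t \<in> {t. \<not> F differentiable (at t)}"
    then obtain p q where "p \<in> \<rat>" "q \<in> \<rat>" "0 \<le> p" "p < q" "t \<in> steep F q \<inter> flat F p"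
      using differentiable_of_not_steep_flat by blast
    moreover obtain n where "t \<in> ball 0 (real n)"
      using reals_Archimedean2[of "\<bar>t\<bar>"] by (auto simp: dist_real_def)
    ultimately show "t \<in> \<Union>(?E ` ?I)" by (intro UN_I[of "(p, q, n)"]) auto
  qed
qed

end

text \<open>Extended by constants beyond the endpoints, \<open>f\<close> stays Lipschitz with
  constant \<open>L\<close>. Adding \<open>L * t\<close> makes it monotone without affecting
  differentiability.\<close>

lemma negligible_not_differentiable_lipschitz_real:
  fixes f :: "real \<Rightarrow> real"
  assumes "L-lipschitz_on {a..b} f"
  shows "negligible {t\<in>{a<..<b}. \<not> f differentiable (at t)}"
proof (cases "a < b")
  case True
  define g where "g t = f (max a (min b t))" for t
  have L: "L \<ge> 0" using assms by (rule lipschitz_on_nonneg)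
  have g: "\<bar>g s - g t\<bar> \<le> L * \<bar>s - t\<bar>" for s t
  proof -
    have "\<bar>g s - g t\<bar> \<le> L * \<bar>max a (min b s) - max a (min b t)\<bar>"
      using lipschitz_onD[OF assms, of "max a (min b s)" "max a (min b t)"] True
      by (auto simp: g_def dist_real_def)
    also have "\<dots> \<le> L * \<bar>s - t\<bar>" by (rule mult_left_mono) (use L in auto)
    finally show ?thesis .
  qed
  define F where "F t = g t + L * t" for t
  have "mono F"
  proof (rule monoI)
    fix s t :: real assume "s \<le> t"
    then show "F s \<le> F t" using g[of s t] by (auto simp: F_def abs_le_iff algebra_simps)
  qed
  moreover have "(2 * L)-lipschitz_on UNIV F"
  proof (rule lipschitz_onI)
    fix s t :: real
    have "\<bar>F s - F t\<bar> \<le> \<bar>g s - g t\<bar> + \<bar>L * (s - t)\<bar>" by (simp add: F_def algebra_simps)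
    then show "dist (F s) (F t) \<le> 2 * L * dist s t"
      using g[of s t] L by (simp add: dist_real_def abs_mult)
  qed (use L in simp)
  ultimately have "negligible {t. \<not> F differentiable (at t)}"
    by (rule negligible_not_differentiable_mono)
  moreover have "f differentiable (at t)" if "t \<in> {a<..<b}" "F differentiable (at t)" for t
  proof -
    have "(\<lambda>s. F s - L * s) differentiable (at t)"
      using that by (intro differentiable_diff differentiable_mult) auto
    then obtain D where "((\<lambda>s. F s - L * s) has_derivative D) (at t)" by (auto simp: differentiable_def)
    then have "(f has_derivative D) (at t)"
      by (rule has_derivative_transform_within_open[of _ _ _ _ "{a<..<b}"])
         (use that in \<open>auto simp: F_def g_def\<close>)
    then show ?thesis by (auto simp: differentiable_def)
  qed
  ultimately show ?thesis by (elim negligible_subset) auto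
qed auto

lemma negligible_not_differentiable_lipschitz:
  fixes f :: "real \<Rightarrow> 'a::euclidean_space"
  assumes "L-lipschitz_on {a..b} f"
  shows "negligible {t\<in>{a<..<b}. \<not> f differentiable (at t)}"
proof (rule negligible_subset)
  have "L-lipschitz_on {a..b} (\<lambda>t. f t \<bullet> i)" if "i \<in> Basis" for i
  proof (rule lipschitz_onI)
    fix s t assume st: "s \<in> {a..b}" "t \<in> {a..b}"
    have "dist (f s \<bullet> i) (f t \<bullet> i) \<le> norm (f s - f t)"
      using Basis_le_norm[OF that, of "f s - f t"] by (simp add: dist_real_def inner_diff_left)
    then show "dist (f s \<bullet> i) (f t \<bullet> i) \<le> L * dist s t"
      using lipschitz_onD[OF assms st] by (simp add: dist_norm)
  qed (use assms in \<open>rule lipschitz_on_nonneg\<close>)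
  then have "negligible {t\<in>{a<..<b}. \<not> (\<lambda>t. f t \<bullet> i) differentiable (at t)}" if "i \<in> Basis" for i
    using that by (intro negligible_not_differentiable_lipschitz_real)
  then show "negligible (\<Union>i\<in>Basis. {t\<in>{a<..<b}. \<not> (\<lambda>t. f t \<bullet> i) differentiable (at t)})"
    by (intro negligible_Union) auto
  show "{t\<in>{a<..<b}. \<not> f differentiable (at t)} \<subseteq> (\<Union>i\<in>Basis. {t\<in>{a<..<b}. \<not> (\<lambda>t. f t \<bullet> i) differentiable (at t)})"
    using differentiable_componentwise_within[of f _ UNIV] by auto
qed

section \<open>Discretising the alternating signature\<close>

text \<open>Gives measurability of the signature integrand, which is known only almost everywhere as
  a limit of step functions.\<close>

lemma measurable_completion_cong_AE:
  assumes g: "g \<in> completion M \<rightarrow>\<^sub>M N" and f: "f \<in> space M \<rightarrow> space N"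
    and ae: "AE x in completion M. f x = g x"
  shows "f \<in> completion M \<rightarrow>\<^sub>M N"
proof (rule measurableI)
  show "f x \<in> space N" if "x \<in> space (completion M)" for x using f that by auto
  fix A assume A: "A \<in> sets N"
  obtain Z where Z: "{x \<in> space (completion M). \<not> f x = g x} \<subseteq> Z" "Z \<in> null_sets (completion M)"
    using ae by (rule AE_E3) (auto intro: null_setsI)
  have "f -` A \<inter> Z \<inter> space (completion M) \<in> null_sets (completion M)"
    by (rule null_sets_completion_subset[OF _ Z(2)]) auto
  moreover have "g -` A \<inter> space (completion M) \<in> sets (completion M)" using g A by (rule measurable_sets)
  moreover have "f -` A \<inter> space (completion M) =
      (g -` A \<inter> space (completion M) - Z) \<union> (f -` A \<inter> Z \<inter> space (completion M))"
    using Z(1) by auto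
  ultimately show "f -` A \<inter> space (completion M) \<in> sets (completion M)"
    using Z(2) by (auto intro!: sets.Un sets.Diff dest: null_setsD2)
qed

text \<open>The cylinder over a null set is null in the product measure. As \<open>S\<close> may
  fail to be Borel, a Borel null set \<open>T\<close> containing it takes its place.\<close>

lemma AE_component_notin_null:
  assumes "negligible S"
  shows "AE t :: real ^ 'n in lebesgue. \<forall>j. t $ j \<notin> S"
proof -
  obtain T where T: "T \<in> null_sets lborel" "S \<subseteq> T"
    using assms unfolding negligible_iff_null_sets null_sets_completion_iff2 by blast
  have [measurable]: "T \<in> sets borel" and T0: "emeasure lborel T = 0" using T by (auto simp: null_sets_def)
  interpret product_sigma_finite "\<lambda>_::real ^ 'n. lborel :: real measure" by standard
  have "AE t :: real ^ 'n in lborel. t $ j \<notin> T" for j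
  proof (rule AE_I)
    let ?P = "\<Pi>\<^sub>M b\<in>(Basis :: (real ^ 'n) set). (lborel :: real measure)"
    have ax: "axis j 1 \<in> (Basis :: (real ^ 'n) set)" by (auto simp: Basis_vec_def)
    have m: "{t :: real ^ 'n. t $ j \<in> T} \<in> sets borel" by measurable
    then show "{t :: real ^ 'n. t $ j \<in> T} \<in> sets lborel" by simp
    show "{t :: real ^ 'n \<in> space lborel. \<not> t $ j \<notin> T} \<subseteq> {t. t $ j \<in> T}" by auto
    have comp: "(\<Sum>b\<in>Basis. f b *\<^sub>R b) $ j = f (axis j 1)" for f :: "real ^ 'n \<Rightarrow> real"
      using inner_sum_left_Basis[OF ax, of f] by (simp add: inner_axis)
    have "emeasure lborel {t :: real ^ 'n. t $ j \<in> T} =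
        emeasure ?P ((\<lambda>f. \<Sum>b\<in>Basis. f b *\<^sub>R b) -` {t :: real ^ 'n. t $ j \<in> T} \<inter> space ?P)"
      using m by (subst lborel_eq, subst emeasure_distr) auto
    also have "(\<lambda>f. \<Sum>b\<in>Basis. f b *\<^sub>R b) -` {t :: real ^ 'n. t $ j \<in> T} \<inter> space ?P =
        Pi\<^sub>E Basis (\<lambda>b. if b = axis j 1 then T else UNIV)"
    proof -
      have "(\<forall>b\<in>Basis. f b \<in> (if b = axis j 1 then T else UNIV)) \<longleftrightarrow> f (axis j 1) \<in> T"
        for f :: "real ^ 'n \<Rightarrow> real"
        using ax by (auto split: if_splits)
      then show ?thesis
        unfolding vimage_def mem_Collect_eq comp by (simp add: set_eq_iff space_PiM PiE_iff conj_commute)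
    qed
    also have "emeasure ?P \<dots> = (\<Prod>b\<in>(Basis :: (real ^ 'n) set). emeasure lborel (if b = axis j 1 then T else UNIV))"
      by (rule emeasure_PiM) auto
    \<comment> \<open>The factor of \<open>T\<close> is \<open>0\<close> and any other factor is
      infinite; their product is \<open>0\<close> in \<open>ennreal\<close>.\<close>
    also have "\<dots> = 0" by (rule prod_zero) (use ax T0 in auto)
    finally show "emeasure lborel {t :: real ^ 'n. t $ j \<in> T} = 0" .
  qed
  then have "AE t :: real ^ 'n in lborel. \<forall>j. t $ j \<notin> T" by (simp add: AE_all_countable)
  then have "AE t :: real ^ 'n in lborel. \<forall>j. t $ j \<notin> S" by eventually_elim (use T in auto)
  then show ?thesis by (rule AE_completion)
qed

lemma abs_det_le:
  fixes A :: "real ^ 'n::finite ^ 'n"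
  assumes "\<And>i j. \<bar>A $ i $ j\<bar> \<le> L"
  shows "\<bar>det A\<bar> \<le> fact CARD('n) * L ^ CARD('n)"
proof -
  have "\<bar>det A\<bar> \<le> (\<Sum>p | p permutes (UNIV :: 'n set). \<bar>of_int (sign p) * (\<Prod>i\<in>UNIV. A $ i $ p i)\<bar>)"
    unfolding det_def by (rule sum_abs)
  also have "\<dots> \<le> (\<Sum>p | p permutes (UNIV :: 'n set). L ^ CARD('n))"
  proof (rule sum_mono)
    fix p :: "'n \<Rightarrow> 'n"
    have "\<bar>of_int (sign p) * (\<Prod>i\<in>UNIV. A $ i $ p i)\<bar> = (\<Prod>i\<in>UNIV. \<bar>A $ i $ p i\<bar>)"
      by (auto simp: abs_mult abs_prod sign_def)
    also have "\<dots> \<le> (\<Prod>i\<in>(UNIV :: 'n set). L)" by (rule prod_mono) (use assms in auto)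
    finally show "\<bar>of_int (sign p) * (\<Prod>i\<in>UNIV. A $ i $ p i)\<bar> \<le> L ^ CARD('n)" by simp
  qed
  also have "\<dots> = fact CARD('n) * L ^ CARD('n)"
    using card_permutations[of "UNIV :: 'n set" "CARD('n)"] by simp
  finally show ?thesis .
qed

lemma tendsto_det:
  fixes A :: "'b \<Rightarrow> ((real, 'n::finite) vec, 'n) vec"
  assumes "\<And>i. ((\<lambda>m. A m $ i) \<longlongrightarrow> B $ i) F"
  shows "((\<lambda>m. det (A m)) \<longlongrightarrow> det B) F"
proof -
  have "((\<lambda>m. A m $ i $ j) \<longlongrightarrow> B $ i $ j) F" for i j by (rule tendsto_vec_nth[OF assms])
  then show ?thesis unfolding det_def by (intro tendsto_sum tendsto_mult tendsto_const tendsto_prod)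
qed

section \<open>Riemann sums of the signature over grid cells\<close>

definition increment :: "(real \<Rightarrow> 'a::real_vector) \<Rightarrow> nat \<Rightarrow> nat \<Rightarrow> 'a" where
  "increment x N k = x (real (Suc k) / real N) - x (real k / real N)"

text \<open>The grid interval containing \<open>s\<close> usually has \<open>s\<close> inside. The
  linearisation errors at its two ends are proportional to their distances from \<open>s\<close>,
  and these distances add up to the length of the interval.\<close>

lemma straddling_quotient_tendsto:
  fixes x :: "real \<Rightarrow> 'a::real_normed_vector"
  assumes D: "(x has_vector_derivative D) (at s)" and "0 \<le> s"
  shows "(\<lambda>N. real N *\<^sub>R increment x N (nat \<lfloor>real N * s\<rfloor>)) \<longlonglongrightarrow> D"
proof (rule LIMSEQ_I)
  fix e :: real assume "0 < e"
  then have "0 < e / 2" by simp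
  then obtain \<delta> where \<delta>: "\<delta> > 0" "\<And>y. norm (y - s) < \<delta> \<Longrightarrow> norm (x y - x s - (y - s) *\<^sub>R D) \<le> e / 2 * norm (y - s)"
    using D unfolding has_vector_derivative_def has_derivative_at_alt by blast
  obtain M where M: "inverse (real (Suc M)) < \<delta>" using reals_Archimedean \<delta>(1) by blast
  show "\<exists>no. \<forall>N\<ge>no. norm (real N *\<^sub>R increment x N (nat \<lfloor>real N * s\<rfloor>) - D) < e"
  proof (intro exI[of _ "Suc M"] allI impI)
    fix N assume N: "Suc M \<le> N"
    define n where "n = real N"
    have n: "n > 0" "1 / n < \<delta>"
    proof -
      show "n > 0" using N by (simp add: n_def)
      have "1 / n \<le> inverse (real (Suc M))" using N by (simp add: n_def field_simps)
      then show "1 / n < \<delta>" using M by simp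
    qed
    define k where "k = nat \<lfloor>n * s\<rfloor>"
    have k: "real k \<le> n * s" "n * s < real k + 1"
      using \<open>0 \<le> s\<close> n by (auto simp: k_def)
    define u where "u = real k / n"
    define v where "v = (real k + 1) / n"
    have uv: "u \<le> s" "s < v" "v - u = 1 / n"
      using k n by (auto simp: u_def v_def field_simps)
    have "norm (x v - x s - (v - s) *\<^sub>R D) \<le> e / 2 * (v - s)"
      using \<delta>(2)[of v] uv n by auto
    moreover have "norm (x u - x s - (u - s) *\<^sub>R D) \<le> e / 2 * (s - u)"
      using \<delta>(2)[of u] uv n by auto
    moreover have "norm (x v - x u - (v - u) *\<^sub>R D) \<le>
        norm (x v - x s - (v - s) *\<^sub>R D) + norm (x u - x s - (u - s) *\<^sub>R D)"
      using norm_triangle_ineq4[of "x v - x s - (v - s) *\<^sub>R D" "x u - x s - (u - s) *\<^sub>R D"]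
      by (simp add: algebra_simps)
    ultimately have "norm (x v - x u - (v - u) *\<^sub>R D) \<le> e / 2 * (v - u)"
      by (simp add: algebra_simps)
    then have "n * norm (x v - x u - (1 / n) *\<^sub>R D) \<le> n * (e / 2 * (1 / n))"
      unfolding uv(3) using n by (intro mult_left_mono) auto
    moreover have "n *\<^sub>R (x v - x u) - D = n *\<^sub>R (x v - x u - (1 / n) *\<^sub>R D)"
      using n by (simp add: scaleR_diff_right)
    ultimately have "norm (n *\<^sub>R (x v - x u) - D) \<le> e / 2" using n by simp
    then show "norm (real N *\<^sub>R increment x N (nat \<lfloor>real N * s\<rfloor>) - D) < e"
      using \<open>0 < e\<close> by (simp add: increment_def u_def v_def k_def n_def add.commute)
  qed
qed

definition grid_indices :: "nat \<Rightarrow> ('n::{finite,linorder} \<Rightarrow> nat) set" where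
  "grid_indices N = {k. strict_mono k \<and> range k \<subseteq> {..<N}}"

lemma finite_grid_indices: "finite (grid_indices N)"
  unfolding grid_indices_def
  by (rule finite_subset[OF _ finite_PiE[of UNIV "\<lambda>_. {..<N}"]]) (auto simp: PiE_def)

text \<open>Open cells: off the grid hyperplanes, which form a null set, a point determines its cell
  by taking floors.\<close>

definition grid_cell :: "nat \<Rightarrow> ('n::finite \<Rightarrow> nat) \<Rightarrow> (real ^ 'n) set" where
  "grid_cell N k = box (\<chi> j. real (k j) / real N) (\<chi> j. real (Suc (k j)) / real N)"

lemma measure_grid_cell: "N > 0 \<Longrightarrow> measure lebesgue (grid_cell N k :: (real ^ 'n::finite) set) = (1 / real N) ^ CARD('n)"
proof -
  assume N: "N > 0"
  let ?a = "\<chi> j. real (k j) / real N" and ?b = "\<chi> j. real (Suc (k j)) / real N"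
  have "cbox ?a ?b \<noteq> {}" by (auto simp: interval_ne_empty_cart divide_right_mono)
  then have "measure lborel (cbox ?a ?b) = (\<Prod>j\<in>(UNIV :: 'n set). 1 / real N)"
    by (subst content_cbox_cart) (auto simp: diff_divide_distrib[symmetric])
  moreover have "measure lborel (box ?a ?b) = measure lborel (cbox ?a ?b)"
    using \<open>cbox ?a ?b \<noteq> {}\<close> by (simp add: measure_lborel_box_eq measure_lborel_cbox_eq)
  moreover have "measure lebesgue (box ?a ?b) = measure lborel (box ?a ?b)"
    by (simp add: measure_completion)
  ultimately show ?thesis by (simp add: grid_cell_def)
qed

lemma mem_grid_cell_iff:
  assumes N: "N > 0" and t: "\<And>j i. t $ j \<noteq> real i / real N" "\<And>j. 0 \<le> t $ j"
  shows "t \<in> grid_cell N k \<longleftrightarrow> k = (\<lambda>j. nat \<lfloor>real N * t $ j\<rfloor>)"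
proof -
  have "t \<in> grid_cell N k \<longleftrightarrow> (\<forall>j. real (k j) < real N * t $ j \<and> real N * t $ j < real (k j) + 1)"
    using N by (auto simp: grid_cell_def mem_box_cart field_simps)
  also have "\<dots> \<longleftrightarrow> (\<forall>j. k j = nat \<lfloor>real N * t $ j\<rfloor>)"
  proof (intro all_cong1)
    fix j
    have ne: "real N * t $ j \<noteq> real (k j)" using t(1)[of j "k j"] N by (auto simp: field_simps)
    have nn: "0 \<le> real N * t $ j" using t(2)[of j] by simp
    show "(real (k j) < real N * t $ j \<and> real N * t $ j < real (k j) + 1) \<longleftrightarrow> k j = nat \<lfloor>real N * t $ j\<rfloor>"
    proof
      assume "real (k j) < real N * t $ j \<and> real N * t $ j < real (k j) + 1"
      then have "\<lfloor>real N * t $ j\<rfloor> = int (k j)" by (intro floor_unique) auto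
      then show "k j = nat \<lfloor>real N * t $ j\<rfloor>" by simp
    next
      assume k: "k j = nat \<lfloor>real N * t $ j\<rfloor>"
      then have "real (k j) = of_int \<lfloor>real N * t $ j\<rfloor>" using nn by simp
      then show "real (k j) < real N * t $ j \<and> real N * t $ j < real (k j) + 1"
        using ne of_int_floor_le[of "real N * t $ j"] floor_correct[of "real N * t $ j"] by linarith
    qed
  qed
  also have "\<dots> \<longleftrightarrow> k = (\<lambda>j. nat \<lfloor>real N * t $ j\<rfloor>)" by (auto simp: fun_eq_iff)
  finally show ?thesis .
qed

text \<open>The factor \<open>real N ^ CARD('n)\<close> cancels the volume of a cell, so the
  integral is the plain sum of determinants. Strictly increasing indices select the cells that lie
  entirely inside \<open>time_simplex\<close>.\<close>

definition step_integrand :: "(real \<Rightarrow> (real, 'n::{finite,linorder}) vec) \<Rightarrow> nat \<Rightarrow> (real, 'n) vec \<Rightarrow> real" where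
  "step_integrand x N t = (\<Sum>k\<in>grid_indices N.
     (real N ^ CARD('n) * det (\<chi> j. increment x N (k j))) * indicator (grid_cell N k) t)"

text \<open>A point of the simplex in a cell outside \<open>grid_indices\<close> has two coordinates
  in the same grid interval. Then two rows coincide and the determinant is \<open>0\<close>, so
  cells across the diagonals contribute nothing.\<close>

lemma step_integrand_eq:
  fixes t :: "(real, 'n::{finite,linorder}) vec"
  assumes N: "N > 0" and t: "\<And>j i. t $ j \<noteq> real i / real N"
  shows "step_integrand x N t =
    indicator time_simplex t * det (\<chi> j. real N *\<^sub>R increment x N (nat \<lfloor>real N * t $ j\<rfloor>))"
proof (cases "t \<in> time_simplex")
  case False
  have "t \<notin> grid_cell N k" if k: "k \<in> grid_indices N" for k
  proof
    assume "t \<in> grid_cell N k"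
    then have b: "real (k j) / real N < t $ j" "t $ j < real (Suc (k j)) / real N" for j
      by (auto simp: grid_cell_def mem_box_cart)
    have "t \<in> time_simplex" unfolding time_simplex_def
    proof (intro CollectI conjI allI impI)
      fix i j
      have "0 \<le> real (k i) / real N" by simp
      then show "0 \<le> t $ i" using b(1)[of i] by linarith
      have "k i < N" using k by (auto simp: grid_indices_def)
      then have "real (Suc (k i)) / real N \<le> 1" by (simp add: divide_le_eq)
      then show "t $ i \<le> 1" using b(2)[of i] by linarith
      assume "i < j"
      then have "Suc (k i) \<le> k j" using k by (auto simp: grid_indices_def strict_mono_def Suc_le_eq)
      then have "real (Suc (k i)) / real N \<le> real (k j) / real N" by (intro divide_right_mono) auto
      then show "t $ i < t $ j" using b(2)[of i] b(1)[of j] by linarith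
    qed
    then show False using False by simp
  qed
  then show ?thesis using False by (simp add: step_integrand_def)
next
  case True
  then have t0: "0 \<le> t $ j" and t1: "t $ j \<le> 1" for j by (auto simp: time_simplex_def)
  define \<kappa> where "\<kappa> j = nat \<lfloor>real N * t $ j\<rfloor>" for j
  have cell: "t \<in> grid_cell N k \<longleftrightarrow> k = \<kappa>" for k
    using mem_grid_cell_iff[OF N t t0, of k] by (simp add: \<kappa>_def fun_eq_iff)
  have \<kappa>_less: "\<kappa> j < N" for j
  proof -
    have "t $ j \<noteq> 1" using t[of j N] N by simp
    then have "t $ j < 1" using t1[of j] by linarith
    then have "real N * t $ j < real N" using N by simp
    then show ?thesis using t0[of j] by (simp add: \<kappa>_def nat_less_iff floor_less_iff)
  qed
  have mono: "\<kappa> i \<le> \<kappa> j" if "i < j" for i j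
  proof -
    have "t $ i \<le> t $ j" using True that by (auto simp: time_simplex_def less_imp_le)
    then show ?thesis unfolding \<kappa>_def by (intro nat_mono floor_mono mult_left_mono) auto
  qed
  have step_sum: "step_integrand x N t = (\<Sum>k\<in>grid_indices N.
     if k = \<kappa> then real N ^ CARD('n) * det (\<chi> j. increment x N (\<kappa> j)) else 0)"
    unfolding step_integrand_def by (intro sum.cong) (auto simp: indicator_def cell)
  have det_eq: "det (\<chi> j. real N *\<^sub>R increment x N (\<kappa> j)) = real N ^ CARD('n) * det (\<chi> j. increment x N (\<kappa> j))"
    using det_rows_mul[of "\<lambda>_. real N" "\<lambda>j. increment x N (\<kappa> j)"]
    by (simp add: scalar_mult_eq_scaleR)
  have "step_integrand x N t =
      indicator time_simplex t * det (\<chi> j. real N *\<^sub>R increment x N (\<kappa> j))"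
  proof (cases "strict_mono \<kappa>")
    case strict: True
    then have "\<kappa> \<in> grid_indices N" using \<kappa>_less by (auto simp: grid_indices_def)
    then have "step_integrand x N t = real N ^ CARD('n) * det (\<chi> j. increment x N (\<kappa> j))"
      using step_sum by (simp add: finite_grid_indices)
    then show ?thesis using True det_eq by simp
  next
    case False
    then obtain i j where "i < j" "\<not> \<kappa> i < \<kappa> j" unfolding strict_mono_def by blast
    then have ij: "i \<noteq> j" "\<kappa> i = \<kappa> j" using mono[of i j] by auto
    have det0: "det (\<chi> j. increment x N (\<kappa> j)) = 0"
      by (rule det_identical_rows[OF ij(1)]) (use ij in \<open>simp add: row_def\<close>)
    then have "step_integrand x N t = 0" using step_sum by (simp add: sum.neutral)
    then show ?thesis using det0 det_eq by simp
  qed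
  then show ?thesis by (simp only: \<kappa>_def)
qed

lemma sum_grid_indices:
  fixes G :: "(real, 'n::{finite,linorder}) vec list \<Rightarrow> real"
  shows "(\<Sum>k\<in>grid_indices N. det (\<chi> j::'n. (w (k j) :: (real, 'n) vec))) = increasing_sum N 0 CARD('n) (\<lambda>l. ldet (map w l))"
  unfolding sum_increasing_lists[symmetric]
proof (rule sum.reindex_bij_witness[of _ "\<lambda>l j. l ! idx j" "\<lambda>k. map (k \<circ> inv_into UNIV (idx :: 'n \<Rightarrow> nat)) [0..<CARD('n)]"])
  have inv: "inv_into UNIV idx (idx j) = j" for j :: 'n
    using strict_mono_imp_inj_on[OF strict_mono_idx] by (rule inv_f_f)
  have inv2: "idx (inv_into UNIV (idx :: 'n \<Rightarrow> nat) r) = r" if "r < CARD('n)" for r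
    using that bij_betw_imp_surj_on[OF bij_betw_idx[where 'm = 'n]] by (intro f_inv_into_f) auto
  have inv_less: "inv_into UNIV (idx :: 'n \<Rightarrow> nat) r < inv_into UNIV idx s" if "r < s" "s < CARD('n)" for r s
    using that inv2[of r] inv2[of s] strict_mono_less[OF strict_mono_idx[where 'm = 'n]]
    by (metis less_trans)
  fix k :: "'n \<Rightarrow> nat" assume k: "k \<in> grid_indices N"
  then have k_less: "k j < N" for j by (auto simp: grid_indices_def)
  show 1: "(\<lambda>j. map (k \<circ> inv_into UNIV (idx :: 'n \<Rightarrow> nat)) [0..<CARD('n)] ! idx j) = k"
    using idx_less[where 'm = 'n] by (auto simp: inv)
  show "map (k \<circ> inv_into UNIV (idx :: 'n \<Rightarrow> nat)) [0..<CARD('n)] \<in> increasing_lists N 0 CARD('n)"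
  proof -
    have "strict_mono k" using k by (simp add: grid_indices_def)
    then show ?thesis
      using k_less inv_less by (auto simp: increasing_lists_def sorted_wrt_iff_nth_less strict_mono_less)
  qed
  show "ldet (map w (map (k \<circ> inv_into UNIV (idx :: 'n \<Rightarrow> nat)) [0..<CARD('n)])) = det (\<chi> j. w (k j))"
    unfolding ldet_def using idx_less[where 'm = 'n] by (intro arg_cong[of _ _ det]) (simp add: vec_eq_iff inv)
next
  have inv2: "idx (inv_into UNIV (idx :: 'n \<Rightarrow> nat) r) = r" if "r < CARD('n)" for r
    using that bij_betw_imp_surj_on[OF bij_betw_idx[where 'm = 'n]] by (intro f_inv_into_f) auto
  fix l assume l: "l \<in> increasing_lists N 0 CARD('n)"
  then have len: "length l = CARD('n)" by (simp add: increasing_lists_def)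
  show "map ((\<lambda>j. l ! idx j) \<circ> inv_into UNIV (idx :: 'n \<Rightarrow> nat)) [0..<CARD('n)] = l"
    by (rule nth_equalityI) (auto simp: len inv2)
  show "(\<lambda>j::'n. l ! idx j) \<in> grid_indices N"
    unfolding grid_indices_def
  proof (intro CollectI conjI strict_monoI)
    fix i j :: 'n assume "i < j"
    then have "idx i < idx j" by (rule strict_monoD[OF strict_mono_idx])
    then show "l ! idx i < l ! idx j"
      using l idx_less[of j] len by (simp add: increasing_lists_def sorted_wrt_iff_nth_less)
  next
    have "l ! idx j \<in> set l" for j :: 'n using idx_less[of j] len by simp
    moreover have "set l \<subseteq> {..<N}" using l by (auto simp: increasing_lists_def)
    ultimately show "range (\<lambda>j::'n. l ! idx j) \<subseteq> {..<N}" by blast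
  qed
qed

lemma integral_step_integrand:
  fixes x :: "real \<Rightarrow> (real, 'n::{finite,linorder}) vec"
  assumes "N > 0"
  shows "(\<integral>t. step_integrand x N t \<partial>lebesgue) = increasing_sum N 0 CARD('n) (\<lambda>l. ldet (map (increment x N) l))"
proof -
  have fin: "emeasure lebesgue (grid_cell N k :: (real, 'n) vec set) < \<infinity>" for k
    unfolding grid_cell_def using emeasure_bounded_finite[OF bounded_box] by simp
  have "(\<integral>t. step_integrand x N t \<partial>lebesgue) = (\<Sum>k\<in>grid_indices N.
      (real N ^ CARD('n) * det (\<chi> j. increment x N (k j))) * measure lebesgue (grid_cell N k :: (real, 'n) vec set))"
    unfolding step_integrand_def using fin
    by (subst Bochner_Integration.integral_sum) (auto simp: grid_cell_def intro!: integrable_real_indicator)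
  also have "\<dots> = (\<Sum>k\<in>grid_indices N. det (\<chi> j::'n. increment x N (k j)))"
    using assms by (intro sum.cong) (auto simp: measure_grid_cell power_one_over)
  finally show ?thesis by (simp add: sum_grid_indices)
qed

lemma increasing_sum_increment_tendsto:
  fixes x :: "real \<Rightarrow> (real, 'n::{finite,linorder}) vec"
  assumes "lipschitz_path x"
  shows "(\<lambda>N. increasing_sum (Suc N) 0 CARD('n) (\<lambda>l. ldet (map (increment x (Suc N)) l)) / fact CARD('n))
    \<longlonglongrightarrow> alternating_signature x"
proof -
  obtain L where L: "L-lipschitz_on {0..1} x" using assms by (auto simp: lipschitz_path_def)
  \<comment> \<open>The rational grid points join the exceptional set so that one null set serves
    all \<open>N\<close>. They include \<open>0\<close> and \<open>1\<close>, hence times outside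
    \<open>B\<close> are interior to the unit interval.\<close>
  define B where "B = {t\<in>{0<..<1}. \<not> x differentiable (at t)} \<union> {real i / real m | i m. True}"
  have "{real i / real m | i m. True} = (\<lambda>(i, m). real i / real m) ` UNIV" by auto
  then have "countable {real i / real m | i m. True}" by simp
  then have "negligible {real i / real m | i m. True}"
    unfolding negligible_iff_null_sets by (intro null_sets_completionI countable_imp_null_set_lborel)
  then have "negligible B"
    unfolding B_def using negligible_not_differentiable_lipschitz[OF L] by (intro negligible_Un)
  then have ae: "AE t :: (real, 'n) vec in lebesgue. \<forall>j. t $ j \<notin> B" by (rule AE_component_notin_null)
  define f where "f t = indicator time_simplex t *
    det (\<chi> i j. vector_derivative x (at (t $ j) within {0..1}) $ i)" for t :: "(real, 'n) vec"
  have step: "step_integrand x (Suc N) t =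
      indicator time_simplex t * det (\<chi> j. real (Suc N) *\<^sub>R increment x (Suc N) (nat \<lfloor>real (Suc N) * t $ j\<rfloor>))"
    if "\<forall>j. t $ j \<notin> B" for t N
    by (rule step_integrand_eq) (use that in \<open>auto simp: B_def simp del: of_nat_Suc\<close>)
  have conv: "(\<lambda>N. step_integrand x (Suc N) t) \<longlonglongrightarrow> f t" if tB: "\<forall>j. t $ j \<notin> B" for t
  proof (cases "t \<in> time_simplex")
    case False
    then show ?thesis using step[OF tB] by (simp add: f_def)
  next
    case True
    have "(\<lambda>N. real (Suc N) *\<^sub>R increment x (Suc N) (nat \<lfloor>real (Suc N) * t $ j\<rfloor>))
      \<longlonglongrightarrow> vector_derivative x (at (t $ j) within {0..1})" for j
    proof -
      have "t $ j \<noteq> real i / real m" for i m using tB by (auto simp: B_def)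
      from this[of 0 1] this[of 1 1] have tj: "0 < t $ j" "t $ j < 1"
        using True by (auto simp: time_simplex_def less_le)
      then have "x differentiable (at (t $ j))" using tB by (auto simp: B_def)
      then have "(x has_vector_derivative vector_derivative x (at (t $ j))) (at (t $ j))"
        by (simp add: vector_derivative_works)
      moreover have "at (t $ j) within {0..1} = at (t $ j)"
        using tj by (intro at_within_interior) auto
      ultimately have "(x has_vector_derivative vector_derivative x (at (t $ j) within {0..1})) (at (t $ j))"
        by simp
      then show ?thesis
        using tj by (intro LIMSEQ_Suc straddling_quotient_tendsto) auto
    qed
    then have "(\<lambda>N. det (\<chi> j. real (Suc N) *\<^sub>R increment x (Suc N) (nat \<lfloor>real (Suc N) * t $ j\<rfloor>)))
        \<longlonglongrightarrow> det (\<chi> j. vector_derivative x (at (t $ j) within {0..1}))"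
      by (intro tendsto_det) simp
    \<comment> \<open>Times index the rows here and the columns in
      \<open>alternating_signature\<close>.\<close>
    also have "(\<chi> j. vector_derivative x (at (t $ j) within {0..1})) =
        transpose (\<chi> i j. vector_derivative x (at (t $ j) within {0..1}) $ i)"
      by (simp add: transpose_def vec_eq_iff)
    finally show ?thesis using step[OF tB] True by (simp add: f_def)
  qed
  have meas: "step_integrand x (Suc N) \<in> borel_measurable lebesgue" for N
    unfolding step_integrand_def[abs_def] grid_cell_def
    by (intro borel_measurable_sum borel_measurable_times borel_measurable_const borel_measurable_indicator) auto
  \<comment> \<open>No measurability of \<open>vector_derivative\<close> or of
    \<open>time_simplex\<close> enters: \<open>f\<close> agrees almost everywhere with a limit of
    step functions.\<close>
  have "f \<in> borel_measurable lebesgue"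
  proof (rule measurable_completion_cong_AE)
    show "(\<lambda>t. lim (\<lambda>N. step_integrand x (Suc N) t)) \<in> borel_measurable lebesgue"
      using meas by (rule borel_measurable_lim_metric)
    show "AE t in lebesgue. f t = lim (\<lambda>N. step_integrand x (Suc N) t)"
      using ae by eventually_elim (use conv limI in metis)
  qed simp
  have bound: "norm (step_integrand x (Suc N) t) \<le> fact CARD('n) * L ^ CARD('n) * indicator (cbox 0 1) t"
    if tB: "\<forall>j. t $ j \<notin> B" for N t
  proof (cases "t \<in> time_simplex")
    case False
    have "L \<ge> 0" using L by (rule lipschitz_on_nonneg)
    then show ?thesis using step[OF tB] False by (simp add: zero_le_power)
  next
    case True
    \<comment> \<open>Rescaling by the number of cells turns an increment into a difference
      quotient, bounded by the Lipschitz constant uniformly in \<open>N\<close>. Excluding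
      \<open>t $ j = 1\<close> keeps the cell inside the unit interval.\<close>
    have "norm (real (Suc N) *\<^sub>R increment x (Suc N) (nat \<lfloor>real (Suc N) * t $ j\<rfloor>)) \<le> L" for j
    proof -
      define k where "k = nat \<lfloor>real (Suc N) * t $ j\<rfloor>"
      have "t $ j \<noteq> real 1 / real 1" using tB unfolding B_def by blast
      then have tj: "0 \<le> t $ j" "t $ j < 1" using True by (auto simp: time_simplex_def less_le)
      then have "real (Suc N) * t $ j < real (Suc N) * 1" by (intro mult_strict_left_mono) auto
      then have "k < Suc N" using tj unfolding k_def by (simp add: nat_less_iff floor_less_iff)
      then have "real (Suc k) / real (Suc N) \<in> {0..1}" "real k / real (Suc N) \<in> {0..1}"
        by (auto simp: divide_le_eq)
      from lipschitz_onD[OF L this]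
      have "norm (increment x (Suc N) k) \<le> L * \<bar>real (Suc k) / real (Suc N) - real k / real (Suc N)\<bar>"
        by (simp add: increment_def dist_norm)
      also have "\<bar>real (Suc k) / real (Suc N) - real k / real (Suc N)\<bar> = 1 / real (Suc N)"
        by (simp add: diff_divide_distrib[symmetric])
      finally show ?thesis unfolding k_def[symmetric] by (simp add: field_simps del: of_nat_Suc)
    qed
    then have "\<bar>(\<chi> j. real (Suc N) *\<^sub>R increment x (Suc N) (nat \<lfloor>real (Suc N) * t $ j\<rfloor>)) $ i $ j\<bar> \<le> L" for i j
      using component_le_norm_cart order_trans by (metis vec_lambda_beta)
    then have "\<bar>det (\<chi> j. real (Suc N) *\<^sub>R increment x (Suc N) (nat \<lfloor>real (Suc N) * t $ j\<rfloor>))\<bar> \<le> fact CARD('n) * L ^ CARD('n)"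
      by (rule abs_det_le)
    moreover have "t \<in> cbox 0 1" using True by (auto simp: time_simplex_def mem_box_cart)
    ultimately show ?thesis using step[OF tB] True by simp
  qed
  have "(\<lambda>N. \<integral>t. step_integrand x (Suc N) t \<partial>lebesgue) \<longlonglongrightarrow> (\<integral>t. f t \<partial>lebesgue)"
  proof (rule integral_dominated_convergence)
    show "integrable lebesgue (\<lambda>t. fact CARD('n) * L ^ CARD('n) * indicator (cbox 0 1 :: (real, 'n) vec set) t)"
      using emeasure_bounded_finite[OF bounded_cbox, of "0 :: (real, 'n) vec" 1]
      by (intro integrable_mult_right integrable_real_indicator) auto
    show "AE t in lebesgue. (\<lambda>N. step_integrand x (Suc N) t) \<longlonglongrightarrow> f t"
      using ae by eventually_elim (rule conv)
    show "AE t in lebesgue. norm (step_integrand x (Suc N) t) \<le> fact CARD('n) * L ^ CARD('n) * indicator (cbox 0 1) t" for N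
      using ae by eventually_elim (rule bound)
  qed (use meas \<open>f \<in> borel_measurable lebesgue\<close> in auto)
  then have "(\<lambda>N. increasing_sum (Suc N) 0 CARD('n) (\<lambda>l. ldet (map (increment x (Suc N)) l))) \<longlonglongrightarrow> (\<integral>t. f t \<partial>lebesgue)"
    by (simp add: integral_step_integrand)
  from tendsto_divide[OF this tendsto_const, of "fact CARD('n)"] show ?thesis
    by (simp add: alternating_signature_def set_lebesgue_integral_def f_def[abs_def])
qed

section \<open>Order paths and cyclic paths on a grid\<close>

lemma order_path_ldet_pos:
  fixes y :: "real \<Rightarrow> (real, 'n::{finite,linorder}) vec"
  assumes "order_path y" "N > 0" "l \<in> increasing_lists (Suc N) 0 (Suc CARD('n))"
  shows "0 < ldet (map (\<lambda>i. homog (y (real i / real N))) l)"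
proof -
  define t where "t k = real (l ! idx k) / real N" for k :: "'n option"
  have len: "length l = CARD('n option)" using assms(3) by (simp add: increasing_lists_def)
  have l: "sorted_wrt (<) l" "set l \<subseteq> {0..<Suc N}" using assms(3) by (auto simp: increasing_lists_def)
  have "strict_mono t"
  proof (rule strict_monoI)
    fix i j :: "'n option" assume "i < j"
    then have "idx i < idx j" using strict_mono_idx by (auto dest: strict_monoD)
    then have "l ! idx i < l ! idx j"
      using l(1) len idx_less[of j] by (simp add: sorted_wrt_iff_nth_less)
    then show "t i < t j" using assms(2) by (simp add: t_def divide_strict_right_mono)
  qed
  moreover have "range t \<subseteq> {0..1}"
  proof clarify
    fix k :: "'n option"
    have "l ! idx k \<in> set l" using len idx_less[of k] by simp
    then have "l ! idx k \<le> N" using l(2) by auto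
    then show "t k \<in> {0..1}" using assms(2) by (simp add: t_def divide_le_eq)
  qed
  ultimately have "0 < det (order_matrix y t)" using assms(1) by (auto simp: order_path_def)
  \<comment> \<open>The columns of \<open>order_matrix\<close> are homogeneous coordinates;
    \<open>ldet\<close> takes them as rows.\<close>
  also have "order_matrix y t = transpose (\<chi> k. map (\<lambda>i. homog (y (real i / real N))) l ! idx k)"
    using len idx_less[where 'm = "'n option"]
    by (auto simp: order_matrix_def transpose_def vec_eq_iff t_def homog_def split: option.split)
  finally show ?thesis by (simp add: ldet_def)
qed

lemma increasing_sum_increment_map:
  "increasing_sum N 0 m (\<lambda>l. ldet (map (increment x N) l)) =
   increasing_sum N 0 m (\<lambda>l. ldet (map (\<lambda>k. x (real (Suc k) / real N) - x (real k / real N)) l))"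
  by (simp add: increment_def[abs_def])

text \<open>The points of \<open>x\<close> may coincide or have vanishing determinants, so they need
  not be triangulated by the Gale lists. But both sides depend on finitely many points only, and
  continuously: the volume by \<open>tendsto_measure_convex\<close>, the determinants as
  polynomials.\<close>

lemma measure_convex_hull_cyclic_grid:
  fixes x :: "real \<Rightarrow> (real, 'n::{finite,linorder}) vec"
  assumes "cyclic_path x" "N > 0"
  shows "measure lebesgue (convex hull ((\<lambda>i. x (real i / real N)) ` {..N})) =
    increasing_sum N 0 CARD('n) (\<lambda>l. ldet (map (increment x N) l)) / fact CARD('n)"
proof -
  obtain y :: "nat \<Rightarrow> real \<Rightarrow> (real, 'n) vec" where y: "\<And>m. order_path (y m)" "uniform_limit {0..1} y x sequentially"
    using assms(1) by (auto simp: cyclic_path_def)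
  have in01: "real i / real N \<in> {0..1}" if "i \<le> N" for i using that assms(2) by (simp add: divide_le_eq)
  have eq: "measure lebesgue (convex hull ((\<lambda>i. y m (real i / real N)) ` {..N})) =
    increasing_sum N 0 CARD('n) (\<lambda>l. ldet (map (increment (y m) N) l)) / fact CARD('n)" for m
    unfolding increasing_sum_increment_map
    using order_path_ldet_pos[OF y(1) assms(2)] by (rule measure_convex_hull_strict)
  have "(\<lambda>m. measure lebesgue (convex hull ((\<lambda>i. y m (real i / real N)) ` {..N})))
    \<longlonglongrightarrow> measure lebesgue (convex hull ((\<lambda>i. x (real i / real N)) ` {..N}))"
  proof (rule tendsto_measure_convex)
    fix e :: real assume "0 < e"
    then have ev: "\<forall>\<^sub>F m in sequentially. \<forall>s\<in>{0..1}. dist (y m s) (x s) < e"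
      using y(2) by (auto simp: uniform_limit_iff)
    show "\<forall>\<^sub>F m in sequentially. \<forall>p\<in>convex hull ((\<lambda>i. y m (real i / real N)) ` {..N}).
        \<exists>q\<in>convex hull ((\<lambda>i. x (real i / real N)) ` {..N}). dist p q < e"
      using ev
    proof eventually_elim
      case (elim m)
      show ?case
        by (intro ballI convex_hull_image_near[where f = "\<lambda>i. y m (real i / real N)" and A = "{..N}"])
           (use elim in01 in auto)
    qed
    show "\<forall>\<^sub>F m in sequentially. \<forall>p\<in>convex hull ((\<lambda>i. x (real i / real N)) ` {..N}).
        \<exists>q\<in>convex hull ((\<lambda>i. y m (real i / real N)) ` {..N}). dist p q < e"
      using ev
    proof eventually_elim
      case (elim m)
      show ?case
        by (intro ballI convex_hull_image_near[where f = "\<lambda>i. x (real i / real N)" and A = "{..N}"])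
           (use elim in01 in \<open>auto simp: dist_commute\<close>)
    qed
  qed (auto intro: finite_imp_compact_convex_hull convex_convex_hull)
  moreover have "(\<lambda>m. increasing_sum N 0 CARD('n) (\<lambda>l. ldet (map (increment (y m) N) l)) / fact CARD('n))
    \<longlonglongrightarrow> increasing_sum N 0 CARD('n) (\<lambda>l. ldet (map (increment x N) l)) / fact CARD('n)"
    unfolding sum_increasing_lists[symmetric]
  proof (intro tendsto_divide tendsto_const tendsto_sum)
    fix l assume l: "l \<in> increasing_lists N 0 CARD('n)"
    have lim: "(\<lambda>m. y m s) \<longlonglongrightarrow> x s" if "s \<in> {0..1}" for s
      using y(2) that by (rule tendsto_uniform_limitI)
    have "(\<lambda>m. increment (y m) N k) \<longlonglongrightarrow> increment x N k" if "k < N" for k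
      unfolding increment_def by (intro tendsto_diff lim in01) (use that in auto)
    moreover have "l ! idx i < N" "idx i < length l" for i :: 'n
      using l idx_less[of i] by (auto simp: increasing_lists_def subset_iff)
    ultimately show "(\<lambda>m. ldet (map (increment (y m) N) l)) \<longlonglongrightarrow> ldet (map (increment x N) l)"
      unfolding ldet_def by (intro tendsto_det) simp
  qed simp
  ultimately show ?thesis unfolding eq using LIMSEQ_unique by blast
qed

theorem theorem3p5:
  fixes x :: "real \<Rightarrow> real ^ 'n::{finite,linorder}"
  assumes "cyclic_path x"
  shows "measure lebesgue (convex hull (x ` {0..1})) = alternating_signature x"
proof -
  have "lipschitz_path x" using assms by (simp add: cyclic_path_def)
  then obtain L where L: "L-lipschitz_on {0..1} x" by (auto simp: lipschitz_path_def)
  define K where "K N = convex hull ((\<lambda>i. x (real i / real (Suc N))) ` {..Suc N})" for N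
  have in01: "real i / real (Suc N) \<in> {0..1}" if "i \<le> Suc N" for i N
    using that by (simp add: divide_le_eq)
  have "(\<lambda>N. measure lebesgue (K N)) \<longlonglongrightarrow> measure lebesgue (convex hull (x ` {0..1}))"
  proof (rule tendsto_measure_convex)
    show "compact (convex hull (x ` {0..1}))"
      using lipschitz_on_continuous_on[OF L] by (intro compact_convex_hull compact_continuous_image) auto
    show "compact (K N)" for N unfolding K_def by (intro finite_imp_compact_convex_hull) auto
    fix e :: real assume "0 < e"
    show "\<forall>\<^sub>F N in sequentially. \<forall>p\<in>K N. \<exists>q\<in>convex hull (x ` {0..1}). dist p q < e"
    proof (intro always_eventually allI ballI)
      fix N p assume "p \<in> K N"
      moreover have "K N \<subseteq> convex hull (x ` {0..1})"
        unfolding K_def by (intro hull_mono) (use in01 in auto)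
      ultimately show "\<exists>q\<in>convex hull (x ` {0..1}). dist p q < e" using \<open>0 < e\<close> by (intro bexI[of _ p]) auto
    qed
    \<comment> \<open>Every time is within \<open>1 / (N + 1)\<close> of a grid time, so every point
      of the curve is within \<open>L / (N + 1)\<close> of a vertex.\<close>
    have "(\<lambda>N. L * inverse (real (Suc N))) \<longlonglongrightarrow> L * 0" by (intro tendsto_intros LIMSEQ_inverse_real_of_nat)
    then have "\<forall>\<^sub>F N in sequentially. L * inverse (real (Suc N)) < e"
      using \<open>0 < e\<close> by (intro order_tendstoD) auto
    then show "\<forall>\<^sub>F N in sequentially. \<forall>p\<in>convex hull (x ` {0..1}). \<exists>q\<in>K N. dist p q < e"
    proof eventually_elim
      case (elim N)
      have near: "\<exists>i\<in>{..Suc N}. dist (x s) (x (real i / real (Suc N))) < e" if s: "s \<in> {0..1}" for s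
      proof -
        \<comment> \<open>For \<open>s = 1\<close> this is the last index \<open>Suc N\<close>,
          which the range \<open>{..Suc N}\<close> contains.\<close>
        define i where "i = nat \<lfloor>real (Suc N) * s\<rfloor>"
        have i: "real i \<le> real (Suc N) * s" "real (Suc N) * s < real i + 1" using s by (auto simp: i_def)
        have "real (Suc N) * s \<le> real (Suc N) * 1" using s by (intro mult_left_mono) auto
        then have "real i \<le> real (Suc N) * 1" using i(1) by (rule order_trans[rotated])
        then have "i \<le> Suc N" by (simp only: of_nat_le_iff mult_1_right)
        have "\<bar>s - real i / real (Suc N)\<bar> \<le> inverse (real (Suc N))"
        proof -
          have eq: "s - real i / real (Suc N) = (real (Suc N) * s - real i) / real (Suc N)"
            by (simp add: diff_divide_distrib del: of_nat_Suc)
          have "0 \<le> (real (Suc N) * s - real i) / real (Suc N)"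
            using i by (intro divide_nonneg_nonneg) simp_all
          moreover have "(real (Suc N) * s - real i) / real (Suc N) \<le> 1 / real (Suc N)"
            using i by (intro divide_right_mono) simp_all
          ultimately show ?thesis unfolding eq by (simp only: inverse_eq_divide abs_of_nonneg)
        qed
        then have "L * \<bar>s - real i / real (Suc N)\<bar> \<le> L * inverse (real (Suc N))"
          using lipschitz_on_nonneg[OF L] by (rule mult_left_mono)
        then have "dist (x s) (x (real i / real (Suc N))) < e"
          using lipschitz_onD[OF L s in01[OF \<open>i \<le> Suc N\<close>]] elim by (simp add: dist_real_def del: of_nat_Suc)
        then show ?thesis using \<open>i \<le> Suc N\<close> by auto
      qed
      show ?case unfolding K_def
        by (intro ballI convex_hull_image_near[where f = x and A = "{0..1}"]) (use near in auto)
    qed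
  qed (auto simp: K_def convex_convex_hull)
  moreover have "(\<lambda>N. measure lebesgue (K N)) \<longlonglongrightarrow> alternating_signature x"
    using increasing_sum_increment_tendsto[OF \<open>lipschitz_path x\<close>] measure_convex_hull_cyclic_grid[OF assms, of "Suc _"]
    by (simp add: K_def)
  ultimately show ?thesis by (rule LIMSEQ_unique)
qed

end
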